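(* Let $\lambda\ge0$, $p_0=\frac{2\lambda}{2\lambda+1}$, and $p\ge p_0$ with $p>0$. There is a constant $c>0$, independent of $f$ and $z$, such that for every $f\in A^p_\lambda(\mathbb{D})$, $$|f(z)|\le c\,\frac{(1-|z|)^{-2/p}}{|1-z^2|^{2\lambda/p}}\|f\|_{A^p_\lambda},\qquad z\in\mathbb{D}.$$
   Context: Fix $\lambda\ge0$; $\mathbb{D}$ is the open unit disk in $\mathbb{C}$. For a complex-valued function $f$ put $D_{\bar z}f(z)=\partial_{\bar z}f(z)-\lambda\frac{f(z)-f(\bar z)}{z-\bar z}$, $z=x+iy$ (at real points the quotient is read as its limit $-i\,\partial_y f$). A $C^2$ (real sense) function $f:\mathbb{D}\to\mathbb{C}$ is $\lambda$-analytic if $D_{\bar z}f=0$ in $\mathbb{D}$. $d\sigma_\lambda(z)=c_\lambda|y|^{2\lambda}dx\,dy$, $z=x+iy$, with $c_\lambda=\frac{\Gamma(\lambda+2)}{\Gamma(\lambda+1/2)\Gamma(1/2)}$. For $0<p<\infty$, $A^p_\lambda(\mathbb{D})$ is the set of $\lambda$-analytic functions $f$ on $\mathbb{D}$ with $\|f\|_{A^p_\lambda}=\left(\int_{\mathbb{D}}|f|^pd\sigma_\lambda\right)^{1/p}<\infty$. *)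

theory Defs
  imports "HOL-Analysis.Analysis"
begin

text \<open>
  Functions on the unit disk are rendered as functions on all of \<open>complex\<close>; every notion below
  only uses their values on \<open>ball 0 1\<close>. Throughout, \<open>complex\<close> is the real Euclidean plane when
  derivatives and Lebesgue measure are concerned.
\<close>

definition C2_on :: "complex set \<Rightarrow> (complex \<Rightarrow> complex) \<Rightarrow> bool" where
  "C2_on S f \<longleftrightarrow>
     (\<exists>(f' :: complex \<Rightarrow> complex \<Rightarrow>\<^sub>L complex) (f'' :: complex \<Rightarrow> complex \<Rightarrow>\<^sub>L complex \<Rightarrow>\<^sub>L complex).
        (\<forall>z\<in>S. (f has_derivative blinfun_apply (f' z)) (at z)) \<and>
        (\<forall>z\<in>S. (f' has_derivative blinfun_apply (f'' z)) (at z)) \<and>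
        continuous_on S f'')"

definition partial_x :: "(complex \<Rightarrow> complex) \<Rightarrow> complex \<Rightarrow> complex" where
  "partial_x f z = vector_derivative (\<lambda>t::real. f (z + of_real t)) (at 0)"

definition partial_y :: "(complex \<Rightarrow> complex) \<Rightarrow> complex \<Rightarrow> complex" where
  "partial_y f z = vector_derivative (\<lambda>t::real. f (z + \<i> * of_real t)) (at 0)"

definition partial_zbar :: "(complex \<Rightarrow> complex) \<Rightarrow> complex \<Rightarrow> complex" where
  "partial_zbar f z = (partial_x f z + \<i> * partial_y f z) / 2"

text \<open>
  The difference quotient \<open>(f z - f (cnj z)) / (z - cnj z)\<close> has denominator \<open>2 * \<i> * Im z\<close>; on the
  real axis it is replaced by its limit as \<open>Im z\<close> tends to \<open>0\<close>.
\<close>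
definition reflection_quotient :: "(complex \<Rightarrow> complex) \<Rightarrow> complex \<Rightarrow> complex" where
  "reflection_quotient f z =
     (if Im z = 0 then - \<i> * partial_y f z else (f z - f (cnj z)) / (z - cnj z))"

definition D_zbar :: "real \<Rightarrow> (complex \<Rightarrow> complex) \<Rightarrow> complex \<Rightarrow> complex" where
  "D_zbar lam f z = partial_zbar f z - of_real lam * reflection_quotient f z"

definition lambda_analytic :: "real \<Rightarrow> (complex \<Rightarrow> complex) \<Rightarrow> bool" where
  "lambda_analytic lam f \<longleftrightarrow> C2_on (ball 0 1) f \<and> (\<forall>z\<in>ball 0 1. D_zbar lam f z = 0)"

definition c_lambda :: "real \<Rightarrow> real" where
  "c_lambda lam = Gamma (lam + 2) / (Gamma (lam + 1/2) * Gamma (1/2))"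

text \<open>
  For \<open>lam = 0\<close> the density should be constant, whereas \<open>0 powr 0 = 0\<close>; the two differ only on the
  real axis, a Lebesgue null set.
\<close>
definition sigma_lambda :: "real \<Rightarrow> complex measure" where
  "sigma_lambda lam =
     density lborel (\<lambda>z. ennreal (c_lambda lam * \<bar>Im z\<bar> powr (2 * lam)))"

definition bergman_integral :: "real \<Rightarrow> real \<Rightarrow> (complex \<Rightarrow> complex) \<Rightarrow> ennreal" where
  "bergman_integral lam p f =
     (\<integral>\<^sup>+ z\<in>ball 0 1. ennreal (norm (f z) powr p) \<partial>sigma_lambda lam)"

definition bergman_space :: "real \<Rightarrow> real \<Rightarrow> (complex \<Rightarrow> complex) set" where
  "bergman_space lam p = {f. lambda_analytic lam f \<and> bergman_integral lam p f < \<infinity>}"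

text \<open>Only meaningful on \<open>bergman_space lam p\<close>: \<open>enn2real\<close> sends an infinite integral to \<open>0\<close>.\<close>
definition bergman_norm :: "real \<Rightarrow> real \<Rightarrow> (complex \<Rightarrow> complex) \<Rightarrow> real" where
  "bergman_norm lam p f = enn2real (bergman_integral lam p f) powr (1 / p)"

end

theory Submission
  imports Defs
begin

text \<open>
  The proof replaces \<open>f\<close> by the even function \<open>u z = \<bar>f z\<bar>\<^sup>2 +
  \<bar>f (cnj z)\<bar>\<^sup>2\<close>. Differentiating the first-order equation \<open>D_zbar f =
  0\<close> once more shows that, with \<open>y = Im z\<close>, off the real axis \<open>u_xx + u_yy +
  (2 * lam / y) * u_y \<ge> 0\<close>: the left-hand side is twice the sum of the squared moduli of the
  first derivatives of \<open>f\<close> at \<open>z\<close> and \<open>cnj z\<close>, plus \<open>2 *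
  lam * \<bar>f z - f (cnj z)\<bar>\<^sup>2 / y\<^sup>2\<close>
  (\<open>symmetric_square_subsolution\<close>). The left-hand side times the weight
  \<open>\<bar>y\<bar> powr (2 * lam)\<close> is the divergence of the weight times the gradient of
  \<open>u\<close>, so \<open>u\<close> is subharmonic for the weighted Laplacian. The problem thereby
  becomes a mean value inequality for nonnegative weighted subharmonic functions, with constants
  depending on \<open>lam\<close> only.

  For disks centred on the real axis the weight is homogeneous about the centre, and the normalised
  weighted averages of \<open>u\<close> increase with the radius, as for subharmonic functions
  (\<open>axis_average_mono\<close>). For disks that stay away from the axis at the scale of their
  radius the weight is essentially constant and the averages increase up to a bounded factor
  (\<open>off_axis_average\<close>). Both facts come from one application of the divergence theorem
  (\<open>flux_nonneg\<close>). The delicate points are those whose distance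
  \<open>\<bar>y\<bar>\<close> to the axis is positive but small against the radius \<open>r\<close>.
  There the disk of radius \<open>\<bar>y\<bar> / 2\<close> about \<open>z\<close> lies in the disk of
  radius \<open>2 * \<bar>y\<bar>\<close> about \<open>Re z\<close>, and since \<open>u \<ge> 0\<close>
  the average over the latter can be enlarged to scale \<open>r\<close> by monotonicity. This gives
  \<open>mean_value_inequality\<close>: \<open>u z\<close> is at most a constant times the weighted
  average of \<open>u\<close> over the disk of radius \<open>r\<close> about \<open>z\<close>.

  Finally \<open>u\<close> is replaced by \<open>u powr q\<close> with \<open>q = p / 2\<close>. For
  \<open>q \<ge> 1\<close> this is a convexity argument (\<open>power_mean_value_ge_1\<close>). For
  \<open>q < 1\<close> a device of Hardy and Littlewood is used: at a maximum of \<open>u powr q\<close>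
  times the factor to be gained, the surplus power \<open>u powr (1 - q)\<close> under the integral is
  controlled by its value at that maximum (\<open>power_mean_value_less_1\<close>). The estimate
  obtained involves \<open>\<bar>y\<bar> + (1 - \<bar>z\<bar>)\<close>, which dominates \<open>\<bar>1 -
  z\<^sup>2\<bar> / 2\<close>.
\<close>

section \<open>A divergence inequality on a square\<close>

lemma continuous_on_fst_section:
  assumes "continuous_on (A \<times> B) (\<lambda>(x, y). g x y)" "x \<in> A"
  shows "continuous_on B (\<lambda>y. g x y)"
proof -
  have "continuous_on B (\<lambda>y. (\<lambda>(x, y). g x y) (x, y))"
    by (rule continuous_on_compose2[OF assms(1)]) (use assms(2) in \<open>auto intro!: continuous_intros\<close>)
  then show ?thesis by simp
qed

lemma continuous_on_swap_args:
  assumes "continuous_on (A \<times> B) (\<lambda>(x, y). g x y)"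
  shows "continuous_on (B \<times> A) (\<lambda>(y, x). g x y)"
proof -
  have "continuous_on (B \<times> A) (\<lambda>p. (\<lambda>(x, y). g x y) (snd p, fst p))"
    by (rule continuous_on_compose2[OF assms(1)]) (auto intro!: continuous_intros)
  then show ?thesis by (simp add: case_prod_unfold)
qed

text \<open>
  The divergence theorem for a field \<open>(P, Q)\<close> with vanishing flux through the boundary of
  \<open>[-1, 1]\<^sup>2\<close>, in a form that tolerates a singular horizontal line \<open>y =
  y0\<close>: only \<open>Q\<close> has to be continuous across it. This line will be the real axis,
  where the weight \<open>\<bar>y\<bar> powr (2 * lam)\<close> need not be differentiable. Working with
  one-dimensional integrals over horizontal slices avoids any integrability question for the divergence
  itself.
\<close>
lemma divergence_inequality_square:
  fixes P P' Q Q' S :: "real \<Rightarrow> real \<Rightarrow> real" and y0 :: real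
  assumes dP: "\<And>x y. x \<in> {-1..1} \<Longrightarrow> y \<in> {-1..1} \<Longrightarrow> y \<noteq> y0 \<Longrightarrow>
                ((\<lambda>x. P x y) has_real_derivative P' x y) (at x)"
    and P0: "\<And>y. P (-1) y = 0" "\<And>y. P 1 y = 0"
    and contQ: "continuous_on ({-1..1} \<times> {-1..1}) (\<lambda>(y, x). Q x y)"
    and dQ: "\<And>x y. x \<in> {-1..1} \<Longrightarrow> y \<in> {-1..1} \<Longrightarrow> y \<noteq> y0 \<Longrightarrow>
                ((\<lambda>y. Q x y) has_real_derivative Q' x y) (at y)"
    and contQ': "continuous_on (({-1..1} - {y0}) \<times> {-1..1}) (\<lambda>(y, x). Q' x y)"
    and Q0: "\<And>x. Q x (-1) = 0" "\<And>x. Q x 1 = 0"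
    and contS: "continuous_on ({-1..1} \<times> {-1..1}) (\<lambda>(x, y). S x y)"
    and le: "\<And>x y. x \<in> {-1..1} \<Longrightarrow> y \<in> {-1..1} \<Longrightarrow> y \<noteq> y0 \<Longrightarrow> S x y \<le> P' x y + Q' x y"
  shows "integral (cbox (-1,-1) (1,1)) (\<lambda>(x, y). S x y) \<le> 0"
proof -
  let ?q = "\<lambda>y. integral {-1..1} (\<lambda>x. Q x y)"
  let ?q' = "\<lambda>y. integral {-1..1} (\<lambda>x. Q' x y)"
  let ?s = "\<lambda>y. integral {-1..1} (\<lambda>x. S x y)"
  have contS': "continuous_on (cbox (-1,-1) (1,1)) (\<lambda>(x, y). S x y)"
    using contS by (simp add: cbox_Pair_eq)
  have contS2: "continuous_on ({-1..1} \<times> {-1..1}) (\<lambda>(y, x). S x y)"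
    by (rule continuous_on_swap_args[OF contS])
  have cont_s: "continuous_on {-1..1} ?s"
    using integral_continuous_on_param[of "{-1..1}" "-1" 1 "\<lambda>y x. S x y"] contS2 by simp
  have cont_q: "continuous_on {-1..1} ?q"
    using integral_continuous_on_param[of "{-1..1}" "-1" 1 "\<lambda>y x. Q x y"] contQ by simp
  have slice: "continuous_on {-1..1} (\<lambda>x. Q x y)" if "y \<in> {-1..1}" for y
    by (rule continuous_on_fst_section[OF contQ]) (use that in auto)
  have slice': "continuous_on {-1..1} (\<lambda>x. Q' x y)" if "y \<in> {-1..1}" "y \<noteq> y0" for y
    by (rule continuous_on_fst_section[OF contQ']) (use that in auto)
  have sliceS: "continuous_on {-1..1} (\<lambda>x. S x y)" if "y \<in> {-1..1}" for y
    by (rule continuous_on_fst_section[OF contS2]) (use that in auto)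
  have dq: "(?q has_real_derivative ?q' y) (at y)" if y: "y \<in> {-1<..<1}" "y \<noteq> y0" for y
  proof -
    define U where "U = (if y < y0 then {-1<..<min 1 y0} else {max (-1) y0<..<1})"
    have U: "open U" "convex U" "y \<in> U" "U \<subseteq> {-1..1} - {y0}"
      using y by (auto simp: U_def)
    have U': "t \<in> {-1..1}" "t \<noteq> y0" if "t \<in> U" for t
      using U(4) that by blast+
    have "((\<lambda>y. integral (cbox (-1) 1) (\<lambda>x. Q x y)) has_field_derivative
            integral (cbox (-1) 1) (\<lambda>x. Q' x y)) (at y within U)"
    proof (rule leibniz_rule_field_derivative[where fx = "\<lambda>y x. Q' x y"])
      show "((\<lambda>y. Q x y) has_field_derivative Q' x t) (at t within U)"
        if "t \<in> U" "x \<in> cbox (-1) 1" for x t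
        by (rule has_field_derivative_at_within, rule dQ) (use that U' in auto)
      show "(\<lambda>x. Q x t) integrable_on cbox (-1) 1" if "t \<in> U" for t
        using slice[OF U'(1)[OF that]] by (auto intro: integrable_continuous_interval)
      show "continuous_on (U \<times> cbox (-1) 1) (\<lambda>(y, x). Q' x y)"
        by (rule continuous_on_subset[OF contQ']) (use U in auto)
    qed (use U in auto)
    then show ?thesis using U at_within_open[of y U] by simp
  qed
  \<comment> \<open>On a slice the contribution of \<open>P\<close> integrates to zero, so the slice integral of \<open>S\<close> is bounded by the derivative of the flux \<open>?q\<close>.\<close>
  have s_le: "?s y \<le> ?q' y" if y: "y \<in> {-1..1}" "y \<noteq> y0" for y
  proof -
    have "((\<lambda>x. P' x y) has_integral (P 1 y - P (-1) y)) {-1..1}"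
      by (rule fundamental_theorem_of_calculus)
         (use dP y in \<open>simp_all flip: has_real_derivative_iff_has_vector_derivative
            add: has_field_derivative_at_within\<close>)
    then have P: "((\<lambda>x. P' x y) has_integral 0) {-1..1}" by (simp add: P0)
    have Q: "((\<lambda>x. Q' x y) has_integral ?q' y) {-1..1}"
      using slice'[OF y] by (intro integrable_integral integrable_continuous_interval)
    have "((\<lambda>x. S x y) has_integral ?s y) {-1..1}"
      using sliceS[OF y(1)] by (intro integrable_integral integrable_continuous_interval)
    then have "?s y \<le> 0 + ?q' y"
      by (rule has_integral_le[OF _ has_integral_add[OF P Q]]) (use le y in auto)
    then show ?thesis by simp
  qed
  have "integral (cbox (-1,-1) (1,1)) (\<lambda>(x, y). S x y)
      = integral (cbox (-1) 1) (\<lambda>x. integral (cbox (-1) 1) (\<lambda>y. S x y))"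
    using integral_prod_continuous[OF contS'] by simp
  also have "\<dots> = integral {-1..1} ?s"
    using integral_swap_continuous[OF contS'] by simp
  also have "\<dots> \<le> 0"
  proof -
    \<comment> \<open>The flux \<open>?q\<close> is continuous and vanishes at both ends; taking the value \<open>?s y0\<close> at \<open>y0\<close> makes \<open>?s \<le> ?h\<close> hold there too.\<close>
    let ?h = "\<lambda>y. if y = y0 then ?s y else ?q' y"
    have "(?h has_integral (?q 1 - ?q (-1))) {-1..1}"
      by (rule fundamental_theorem_of_calculus_interior_strong[where S="{y0}"])
         (use cont_q dq in \<open>auto simp: has_real_derivative_iff_has_vector_derivative\<close>)
    then have h: "(?h has_integral 0) {-1..1}" by (simp add: Q0)
    have "(?s has_integral integral {-1..1} ?s) {-1..1}"
      using cont_s by (intro integrable_integral integrable_continuous_interval)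
    then show ?thesis
      by (rule has_integral_le[OF _ h]) (use s_le in auto)
  qed
  finally show ?thesis .
qed

section \<open>The weight and the cutoff\<close>

text \<open>
  The value \<open>1\<close> at \<open>lam = 0\<close> corrects the convention \<open>0 powr 0 =
  0\<close>, so that the weight is continuous for all \<open>lam \<ge> 0\<close>.
\<close>
definition axis_weight :: "real \<Rightarrow> real \<Rightarrow> real" where
  "axis_weight lam y = (if lam = 0 then 1 else \<bar>y\<bar> powr (2 * lam))"

text \<open>
  A radial cutoff, chosen because it is a density whose product with the position vector is a gradient:
  \<open>- (x, y) * bump x y\<close> is the gradient of \<open>(bump x y)\<^sup>2 / 4\<close>, which
  vanishes outside the unit disk.
\<close>
definition bump :: "real \<Rightarrow> real \<Rightarrow> real" where
  "bump x y = max 0 (1 - x\<^sup>2 - y\<^sup>2)"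

lemma axis_weight_nonneg: "0 \<le> axis_weight lam y"
  by (simp add: axis_weight_def)

lemma axis_weight_eq: "y \<noteq> 0 \<Longrightarrow> axis_weight lam y = \<bar>y\<bar> powr (2 * lam)"
  by (simp add: axis_weight_def)

lemma axis_weight_mult: "axis_weight lam (r * y) = axis_weight lam r * axis_weight lam y"
  by (simp add: axis_weight_def abs_mult powr_mult)

lemma continuous_on_axis_weight [continuous_intros]:
  assumes "0 \<le> lam" "continuous_on S g"
  shows "continuous_on S (\<lambda>x. axis_weight lam (g x))"
proof (cases "lam = 0")
  case False
  then show ?thesis
    unfolding axis_weight_def using assms
    by (auto intro!: continuous_intros continuous_on_powr')
qed (simp add: axis_weight_def)

lemma has_real_derivative_axis_weight:
  assumes "y \<noteq> 0"
  shows "(axis_weight lam has_real_derivative 2 * lam / y * axis_weight lam y) (at y)"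
proof (cases "lam = 0")
  case False
  have "((\<lambda>y. \<bar>y\<bar> powr (2 * lam)) has_real_derivative 2 * lam / y * \<bar>y\<bar> powr (2 * lam)) (at y)"
  proof (cases "y > 0")
    case True
    have "((\<lambda>y. y powr (2 * lam)) has_real_derivative 2 * lam * y powr (2 * lam - 1)) (at y)"
      using True by (auto intro!: derivative_eq_intros)
    moreover have "2 * lam * y powr (2 * lam - 1) = 2 * lam / y * \<bar>y\<bar> powr (2 * lam)"
      using True by (simp add: powr_diff)
    ultimately show ?thesis
      using True by (auto intro: has_field_derivative_transform_within_open[where S="{0<..}"])
  next
    case neg: False
    have "((\<lambda>y. (-y) powr (2 * lam)) has_real_derivative - (2 * lam * (-y) powr (2 * lam - 1))) (at y)"
      using neg assms by (auto intro!: derivative_eq_intros)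
    moreover have "- (2 * lam * (-y) powr (2 * lam - 1)) = 2 * lam / y * \<bar>y\<bar> powr (2 * lam)"
      using neg assms by (simp add: powr_diff)
    ultimately show ?thesis
      using neg assms by (auto intro: has_field_derivative_transform_within_open[where S="{..<0}"])
  qed
  then show ?thesis using False by (simp add: axis_weight_def[abs_def])
qed (simp add: axis_weight_def[abs_def])

lemma bump_nonneg: "0 \<le> bump x y"
  by (simp add: bump_def)

lemma bump_commute: "bump x y = bump y x"
  by (simp add: bump_def algebra_simps)

lemma continuous_on_bump [continuous_intros]:
  "continuous_on S f \<Longrightarrow> continuous_on S g \<Longrightarrow> continuous_on S (\<lambda>x. bump (f x) (g x))"
  unfolding bump_def by (intro continuous_intros)

lemma has_real_derivative_max_0_square:
  "((\<lambda>t::real. (max 0 t)\<^sup>2) has_real_derivative 2 * max 0 t) (at t)"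
proof (cases t "0 :: real" rule: linorder_cases)
  case less
  have "((\<lambda>t::real. 0) has_real_derivative 2 * max 0 t) (at t)" using less by simp
  then show ?thesis
    by (rule has_field_derivative_transform_within_open[where S="{..<0}"]) (use less in auto)
next
  case equal
  have "(\<lambda>h::real. ((max 0 (0 + h))\<^sup>2 - (max 0 0)\<^sup>2) / h) = max 0"
    by (auto simp: fun_eq_iff max_def power2_eq_square)
  moreover have "(max 0 \<longlongrightarrow> max 0 (0::real)) (at 0)"
    by (intro tendsto_intros)
  ultimately show ?thesis
    unfolding equal DERIV_def by simp
next
  case greater
  have "((\<lambda>t::real. t\<^sup>2) has_real_derivative 2 * max 0 t) (at t)"
    using greater by (auto intro!: derivative_eq_intros)
  then show ?thesis
    by (rule has_field_derivative_transform_within_open[where S="{0<..}"]) (use greater in auto)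
qed

lemma has_real_derivative_bump_square:
  "((\<lambda>x. (bump x y)\<^sup>2 / 4) has_real_derivative - x * bump x y) (at x)"
proof -
  have "((\<lambda>x. 1 - x\<^sup>2 - y\<^sup>2) has_real_derivative - (2 * x)) (at x)"
    by (auto intro!: derivative_eq_intros)
  from DERIV_cdivide[OF DERIV_chain2[OF has_real_derivative_max_0_square this], of 4]
  show ?thesis by (simp add: bump_def field_simps)
qed

section \<open>Weighted subharmonic functions and their averages\<close>

text \<open>
  Nonnegative subsolutions of the weighted Laplacian on the unit disk, with explicit first and second
  partial derivatives. The differential inequality is imposed only off the real axis: a flux through the
  axis is excluded because the weight vanishes there if \<open>lam > 0\<close>, and because
  \<open>u\<close> is continuously differentiable if \<open>lam = 0\<close>.
\<close>
locale weighted_subsolution =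
  fixes lam :: real and u ux uy uxx uyy :: "complex \<Rightarrow> real"
  assumes lam: "0 \<le> lam"
    and nonneg: "\<And>z. z \<in> ball 0 1 \<Longrightarrow> 0 \<le> u z"
    and du: "\<And>z. z \<in> ball 0 1 \<Longrightarrow>
               (u has_derivative (\<lambda>h. Re h * ux z + Im h * uy z)) (at z)"
    and dux: "\<And>x y. Complex x y \<in> ball 0 1 \<Longrightarrow>
               ((\<lambda>x. ux (Complex x y)) has_real_derivative uxx (Complex x y)) (at x)"
    and duy: "\<And>x y. Complex x y \<in> ball 0 1 \<Longrightarrow>
               ((\<lambda>y. uy (Complex x y)) has_real_derivative uyy (Complex x y)) (at y)"
    and cont_ux: "continuous_on (ball 0 1) ux"
    and cont_uy: "continuous_on (ball 0 1) uy"
    and cont_uyy: "continuous_on (ball 0 1) uyy"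
    and sub: "\<And>z. z \<in> ball 0 1 \<Longrightarrow> Im z \<noteq> 0 \<Longrightarrow>
               0 \<le> uxx z + uyy z + 2 * lam / Im z * uy z"
begin

text \<open>
  The common source of both monotonicity results. Up to the cutoff and the weight, the integrand is the
  derivative in \<open>r\<close> of \<open>u\<close> at the scaled point. It is minus the inner product
  of the gradient of \<open>(bump x y)\<^sup>2 / 4\<close> with the weighted gradient of
  \<open>u\<close>, and integration by parts moves the derivative onto the weighted gradient, whose
  divergence is nonnegative.
\<close>
lemma flux_nonneg:
  assumes r: "0 < r"
    and D: "\<And>x y. x \<in> {-1..1} \<Longrightarrow> y \<in> {-1..1} \<Longrightarrow> Complex (a + r * x) (b + r * y) \<in> ball 0 1"
  shows "0 \<le> integral (cbox (-1,-1) (1,1))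
           (\<lambda>(x, y). (x * ux (Complex (a + r * x) (b + r * y)) + y * uy (Complex (a + r * x) (b + r * y)))
                      * bump x y * axis_weight lam (b + r * y))"
proof -
  let ?p = "\<lambda>x y. Complex (a + r * x) (b + r * y)"
  let ?w = "\<lambda>y. axis_weight lam (b + r * y)"
  let ?w' = "\<lambda>y. 2 * lam / (b + r * y) * axis_weight lam (b + r * y) * r"
  have cp: "continuous_on S (\<lambda>q. g (?p (h q) (k q)))"
    if "continuous_on (ball 0 1) g" "continuous_on S h" "continuous_on S k"
      "\<And>q. q \<in> S \<Longrightarrow> h q \<in> {-1..1} \<and> k q \<in> {-1..1}"
    for S :: "(real \<times> real) set" and g :: "complex \<Rightarrow> real" and h k
    by (rule continuous_on_compose2[OF that(1)])
       (use that(2-4) D in \<open>auto intro!: continuous_intros\<close>)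
  have "integral (cbox (-1,-1) (1,1))
          (\<lambda>(x, y). - ((x * ux (?p x y) + y * uy (?p x y)) * bump x y * ?w y)) \<le> 0"
  proof (rule divergence_inequality_square
      [where ?y0.0 = "- b / r"
        and P = "\<lambda>x y. (bump x y)\<^sup>2 / 4 * (?w y * ux (?p x y))"
        and P' = "\<lambda>x y. - x * bump x y * (?w y * ux (?p x y)) + (?w y * (uxx (?p x y) * r)) * ((bump x y)\<^sup>2 / 4)"
        and Q = "\<lambda>x y. (bump x y)\<^sup>2 / 4 * (?w y * uy (?p x y))"
        and Q' = "\<lambda>x y. - y * bump x y * (?w y * uy (?p x y))
            + (?w' y * uy (?p x y) + uyy (?p x y) * r * ?w y) * ((bump x y)\<^sup>2 / 4)"])
    fix x y :: real assume xy: "x \<in> {-1..1}" "y \<in> {-1..1}" "y \<noteq> - b / r"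
    then have ne: "b + r * y \<noteq> 0" using r by (auto simp: field_simps)
    have 1: "((\<lambda>x. a + r * x) has_real_derivative r) (at x)"
      by (auto intro!: derivative_eq_intros)
    have 2: "((\<lambda>y. b + r * y) has_real_derivative r) (at y)"
      by (auto intro!: derivative_eq_intros)
    have dx: "((\<lambda>x. ux (?p x y)) has_real_derivative uxx (?p x y) * r) (at x)"
      by (rule DERIV_chain2[OF dux 1]) (use D xy in auto)
    have dy: "((\<lambda>y. uy (?p x y)) has_real_derivative uyy (?p x y) * r) (at y)"
      by (rule DERIV_chain2[OF duy 2]) (use D xy in auto)
    have dw: "(?w has_real_derivative ?w' y) (at y)"
      by (rule DERIV_chain2[OF has_real_derivative_axis_weight 2]) (use ne in auto)
    show "((\<lambda>x. (bump x y)\<^sup>2 / 4 * (?w y * ux (?p x y))) has_real_derivative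
       - x * bump x y * (?w y * ux (?p x y)) + (?w y * (uxx (?p x y) * r)) * ((bump x y)\<^sup>2 / 4)) (at x)"
      using DERIV_mult[OF has_real_derivative_bump_square[of y x] DERIV_cmult[OF dx, of "?w y"]] xy
      by simp
    have db: "((\<lambda>y. (bump x y)\<^sup>2 / 4) has_real_derivative - y * bump x y) (at y)"
      using has_real_derivative_bump_square[of x y] by (simp add: bump_commute)
    show "((\<lambda>y. (bump x y)\<^sup>2 / 4 * (?w y * uy (?p x y))) has_real_derivative
       - y * bump x y * (?w y * uy (?p x y))
            + (?w' y * uy (?p x y) + uyy (?p x y) * r * ?w y) * ((bump x y)\<^sup>2 / 4)) (at y)"
      using DERIV_mult[OF db DERIV_mult[OF dw dy]] by simp
    have "0 \<le> r * ?w y * ((bump x y)\<^sup>2 / 4) *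
            (uxx (?p x y) + uyy (?p x y) + 2 * lam / Im (?p x y) * uy (?p x y))"
      using sub[OF D[OF xy(1,2)]] ne r axis_weight_nonneg
      by (intro mult_nonneg_nonneg) auto
    then show "- ((x * ux (?p x y) + y * uy (?p x y)) * bump x y * ?w y)
      \<le> - x * bump x y * (?w y * ux (?p x y)) + (?w y * (uxx (?p x y) * r)) * ((bump x y)\<^sup>2 / 4)
       + (- y * bump x y * (?w y * uy (?p x y))
            + (?w' y * uy (?p x y) + uyy (?p x y) * r * ?w y) * ((bump x y)\<^sup>2 / 4))"
      by (simp add: algebra_simps)
  next
    show "continuous_on ({-1..1} \<times> {-1..1}) (\<lambda>(y, x). (bump x y)\<^sup>2 / 4 * (?w y * uy (?p x y)))"
      unfolding case_prod_unfold
      by (intro continuous_intros cp lam cont_uy) auto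
    show "continuous_on ({-1..1} \<times> {-1..1})
            (\<lambda>(x, y). - ((x * ux (?p x y) + y * uy (?p x y)) * bump x y * ?w y))"
      unfolding case_prod_unfold
      by (intro continuous_intros cp lam cont_uy cont_ux) auto
    show "continuous_on (({-1..1} - {- b / r}) \<times> {-1..1}) (\<lambda>(y, x). - y * bump x y * (?w y * uy (?p x y))
            + (?w' y * uy (?p x y) + uyy (?p x y) * r * ?w y) * ((bump x y)\<^sup>2 / 4))"
      unfolding case_prod_unfold
      by (intro continuous_intros cp lam cont_uy cont_uyy) (use r in \<open>auto simp: field_simps\<close>)
  qed (auto simp: bump_def)
  then show ?thesis by (simp add: case_prod_unfold)
qed

end

lemma axis_weight_mono:
  assumes "0 \<le> lam" "\<bar>x\<bar> \<le> \<bar>y\<bar>"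
  shows "axis_weight lam x \<le> axis_weight lam y"
  using assms by (auto simp: axis_weight_def intro: powr_mono2)

lemma axis_weight_pos: "y \<noteq> 0 \<Longrightarrow> 0 < axis_weight lam y"
  by (simp add: axis_weight_def)

lemma bump_integral_pos:
  assumes lam: "0 \<le> lam"
  shows "0 < integral (cbox (-1,-1) (1,1)) (\<lambda>(x, y). bump x y * axis_weight lam y)" (is "0 < ?I")
proof -
  have c: "continuous_on (cbox (-1,-1) (1,1)) (\<lambda>(x, y). bump x y * axis_weight lam y)"
    unfolding case_prod_unfold by (intro continuous_intros lam)
  have nn: "0 \<le> (case p of (x, y) \<Rightarrow> bump x y * axis_weight lam y)" for p
    by (auto simp: bump_nonneg axis_weight_nonneg split: prod.split)
  have "?I \<noteq> 0"
  proof
    assume "?I = 0"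
    then have "\<forall>p\<in>cbox (-1,-1) (1,1). (case p of (x, y) \<Rightarrow> bump x y * axis_weight lam y) = 0"
      by (subst (asm) integral_cbox_eq_0_iff[OF c])
         (use nn in \<open>auto simp: box_ne_empty Basis_prod_def\<close>)
    then have "bump 0 (1/2) * axis_weight lam (1/2) = 0"
      by (auto simp: cbox_Pair_eq)
    then show False
      using axis_weight_pos[of "1/2" lam] by (simp add: bump_def power2_eq_square)
  qed
  moreover have "0 \<le> ?I"
    using nn by (intro integral_nonneg integrable_continuous c) auto
  ultimately show ?thesis by linarith
qed

text \<open>
  The averages are computed on squares, so the square of half-side \<open>r\<close> about a point has to
  fit into the disk. The factor \<open>2\<close> is a convenient bound for \<open>sqrt 2\<close>.
\<close>
lemma square_in_disk:
  assumes "0 \<le> r" "2 * r < 1 - norm (Complex a b)" "x \<in> {-1..1}" "y \<in> {-1..1}"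
  shows "Complex (a + r * x) (b + r * y) \<in> ball 0 1"
proof -
  have "Complex (a + r * x) (b + r * y) = Complex a b + Complex (r * x) (r * y)"
    by (simp add: complex_eq_iff)
  then have "norm (Complex (a + r * x) (b + r * y)) \<le> norm (Complex a b) + norm (Complex (r * x) (r * y))"
    by (metis norm_triangle_ineq)
  also have "norm (Complex (r * x) (r * y)) \<le> \<bar>r * x\<bar> + \<bar>r * y\<bar>"
    using cmod_le[of "Complex (r * x) (r * y)"] by simp
  also have "\<dots> \<le> 2 * r"
  proof -
    have "r * \<bar>x\<bar> \<le> r * 1" "r * \<bar>y\<bar> \<le> r * 1"
      by (rule mult_left_mono; use assms in auto)+
    then show ?thesis using assms(1) by (simp add: abs_mult)
  qed
  finally show ?thesis using assms by simp
qed

context weighted_subsolution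
begin

lemma continuous_on_u: "continuous_on (ball 0 1) u"
  using du has_derivative_continuous continuous_at_imp_continuous_on by blast

lemma radial_derivative:
  assumes "Complex (a + r * x) (b + r * y) \<in> ball 0 1"
  shows "((\<lambda>r. u (Complex (a + r * x) (b + r * y))) has_real_derivative
     x * ux (Complex (a + r * x) (b + r * y)) + y * uy (Complex (a + r * x) (b + r * y))) (at r)"
proof -
  have "((\<lambda>r. Complex (a + r * x) (b + r * y)) has_derivative (\<lambda>h. h *\<^sub>R Complex x y)) (at r)"
  proof -
    have "((\<lambda>r. Complex a b + r *\<^sub>R Complex x y) has_derivative (\<lambda>h. h *\<^sub>R Complex x y)) (at r)"
      by (auto intro!: derivative_eq_intros)
    moreover have "(\<lambda>r. Complex a b + r *\<^sub>R Complex x y) = (\<lambda>r. Complex (a + r * x) (b + r * y))"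
      by (auto simp: complex_eq_iff)
    ultimately show ?thesis by simp
  qed
  from has_derivative_compose[OF this du[OF assms]]
  show ?thesis
    unfolding has_field_derivative_def
    by (rule has_derivative_eq_rhs) (auto simp: algebra_simps)
qed

lemma continuous_on_scaled:
  assumes g: "continuous_on (ball 0 1) g"
    and R: "2 * R < 1 - norm (Complex a b)"
    and "continuous_on S f" "continuous_on S h" "continuous_on S k"
    and "\<And>q. q \<in> S \<Longrightarrow> f q \<in> {0..R} \<and> h q \<in> {-1..1} \<and> k q \<in> {-1..1}"
  shows "continuous_on S (\<lambda>q. g (Complex (a + f q * h q) (b + f q * k q)) :: real)"
proof (rule continuous_on_compose2[OF g])
  show "continuous_on S (\<lambda>q. Complex (a + f q * h q) (b + f q * k q))"
    using assms by (auto intro!: continuous_intros)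
  show "(\<lambda>q. Complex (a + f q * h q) (b + f q * k q)) ` S \<subseteq> ball 0 1"
  proof (intro image_subsetI)
    fix q assume "q \<in> S"
    then have "f q \<in> {0..R}" "h q \<in> {-1..1}" "k q \<in> {-1..1}" using assms(6) by auto
    then show "Complex (a + f q * h q) (b + f q * k q) \<in> ball 0 1"
      using R by (intro square_in_disk) auto
  qed
qed

lemma bump_average:
  fixes v v' :: "real \<Rightarrow> real \<Rightarrow> real"
  assumes R: "2 * R < 1 - norm (Complex a b)"
    and v: "continuous_on ({0..R} \<times> {-1..1}) (\<lambda>(r, y). v r y)"
    and v': "continuous_on ({0..R} \<times> {-1..1}) (\<lambda>(r, y). v' r y)"
    and dv: "\<And>r y. r \<in> {0<..<R} \<Longrightarrow> y \<in> {-1..1} \<Longrightarrow>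
               ((\<lambda>r. v r y) has_real_derivative v' r y) (at r)"
  defines "A \<equiv> \<lambda>r. integral (cbox (-1,-1) (1,1))
       (\<lambda>(x, y). u (Complex (a + r * x) (b + r * y)) * bump x y * v r y)"
  shows bump_average_continuous: "continuous_on {0..R} A"
    and bump_average_derivative: "\<And>r. r \<in> {0<..<R} \<Longrightarrow>
      (A has_real_derivative
        integral (cbox (-1,-1) (1,1)) (\<lambda>(x, y).
          (x * ux (Complex (a + r * x) (b + r * y)) + y * uy (Complex (a + r * x) (b + r * y)))
             * bump x y * v r y
          + u (Complex (a + r * x) (b + r * y)) * bump x y * v' r y)) (at r)"
proof -
  let ?p = "\<lambda>r x y. Complex (a + r * x) (b + r * y)"
  let ?f = "\<lambda>r (x, y). u (?p r x y) * bump x y * v r y"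
  let ?f' = "\<lambda>r (x, y). (x * ux (?p r x y) + y * uy (?p r x y)) * bump x y * v r y
          + u (?p r x y) * bump x y * v' r y"
  note cs = continuous_on_scaled[OF _ R]
  have cv: "continuous_on ({0..R} \<times> cbox (-1,-1) (1,1)) (\<lambda>q::real\<times>real\<times>real. w (fst q) (snd (snd q)))"
    if "continuous_on ({0..R} \<times> {-1..1}) (\<lambda>(r, y). w r y)" for w :: "real \<Rightarrow> real \<Rightarrow> real"
  proof -
    have "continuous_on ({0..R} \<times> cbox (-1,-1) (1,1)) (\<lambda>q::real\<times>real\<times>real. (\<lambda>(r, y). w r y) (fst q, snd (snd q)))"
      by (rule continuous_on_compose2[OF that])
         (auto simp: cbox_Pair_eq intro!: continuous_intros)
    then show ?thesis by simp
  qed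
  have cf: "continuous_on ({0..R} \<times> cbox (-1,-1) (1,1)) (\<lambda>(r, t). ?f r t)"
    unfolding case_prod_unfold
    by (intro continuous_intros cs continuous_on_u cv v) (auto simp: cbox_Pair_eq)
  have cf': "continuous_on ({0..R} \<times> cbox (-1,-1) (1,1)) (\<lambda>(r, t). ?f' r t)"
    unfolding case_prod_unfold
    by (intro continuous_intros cs continuous_on_u cont_ux cont_uy cv v v') (auto simp: cbox_Pair_eq)
  show "continuous_on {0..R} A"
    unfolding A_def by (rule integral_continuous_on_param[OF cf])
  show "(A has_real_derivative integral (cbox (-1,-1) (1,1)) (?f' r)) (at r)" if r: "r \<in> {0<..<R}" for r
  proof -
    have "((\<lambda>r. integral (cbox (-1,-1) (1,1)) (?f r)) has_real_derivative
            integral (cbox (-1,-1) (1,1)) (?f' r)) (at r within {0<..<R})"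
    proof (rule leibniz_rule_field_derivative[where fx = ?f'])
      fix s :: real and t :: "real \<times> real" assume s: "s \<in> {0<..<R}" and t: "t \<in> cbox (-1,-1) (1,1)"
      obtain x y where [simp]: "t = (x, y)" by (cases t)
      have xy: "x \<in> {-1..1}" "y \<in> {-1..1}" using t by (auto simp: cbox_Pair_eq)
      have "?p s x y \<in> ball 0 1" using s R xy by (intro square_in_disk) auto
      from DERIV_mult[OF DERIV_cmult_right[OF radial_derivative[OF this], of "bump x y"] dv[OF s xy(2)]]
      have "((\<lambda>s. ?f s (x, y)) has_real_derivative ?f' s (x, y)) (at s)"
        by (simp add: mult_ac add_ac)
      then show "((\<lambda>s. ?f s t) has_real_derivative ?f' s t) (at s within {0<..<R})"
        by (simp add: has_field_derivative_at_within)
    next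
      show "?f s integrable_on cbox (-1,-1) (1,1)" if "s \<in> {0<..<R}" for s
        by (intro integrable_continuous continuous_on_fst_section[OF cf]) (use that in auto)
      show "continuous_on ({0<..<R} \<times> cbox (-1,-1) (1,1)) (\<lambda>(r, t). ?f' r t)"
        by (rule continuous_on_subset[OF cf']) auto
    qed (use r in auto)
    then show ?thesis
      using r unfolding A_def by (simp add: at_within_open[of r "{0<..<R}"])
  qed
qed

text \<open>
  Since \<open>axis_weight lam (r * y) = axis_weight lam r * axis_weight lam y\<close>, the normalised
  average about a real point has a weight independent of \<open>r\<close>; its derivative is then
  exactly the flux.
\<close>
lemma axis_average_mono:
  assumes R: "2 * R < 1 - \<bar>a\<bar>" and s: "0 \<le> s" "s \<le> R"
  defines "B \<equiv> \<lambda>r. integral (cbox (-1,-1) (1,1))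
       (\<lambda>(x, y). u (Complex (a + r * x) (0 + r * y)) * bump x y * axis_weight lam y)"
  shows "B s \<le> B R"
proof -
  have R': "2 * R < 1 - norm (Complex a 0)" using R by (simp add: complex_norm)
  have cv: "continuous_on ({0..R} \<times> {-1..1}) (\<lambda>(r, y). axis_weight lam y)"
    unfolding case_prod_unfold by (intro continuous_intros lam)
  note b = bump_average[OF R', of "\<lambda>_ y. axis_weight lam y" "\<lambda>_ _. 0"]
  show ?thesis
  proof (rule DERIV_nonneg_imp_increasing_open[OF s(2)])
    show "continuous_on {s..R} B"
      unfolding B_def by (rule continuous_on_subset[OF b(1)[OF cv]]) (use s in auto)
    fix r assume "s < r" "r < R"
    then have r: "r \<in> {0<..<R}" using s by auto
    let ?g = "\<lambda>(x, y). (x * ux (Complex (a + r * x) (0 + r * y)) + y * uy (Complex (a + r * x) (0 + r * y)))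
             * bump x y * axis_weight lam y"
    have "0 \<le> integral (cbox (-1,-1) (1,1))
           (\<lambda>(x, y). (x * ux (Complex (a + r * x) (0 + r * y)) + y * uy (Complex (a + r * x) (0 + r * y)))
                      * bump x y * axis_weight lam (0 + r * y))"
      by (rule flux_nonneg; (rule square_in_disk)?) (use r R' in auto)
    also have "\<dots> = integral (cbox (-1,-1) (1,1)) (\<lambda>p. axis_weight lam r * ?g p)"
      by (intro integral_cong) (auto simp: axis_weight_mult split: prod.split)
    also have "\<dots> = axis_weight lam r * integral (cbox (-1,-1) (1,1)) ?g"
      by simp
    finally have "0 \<le> integral (cbox (-1,-1) (1,1)) ?g"
      using axis_weight_pos[of r lam] r by (simp add: zero_le_mult_iff)
    moreover have "(B has_real_derivative integral (cbox (-1,-1) (1,1)) ?g) (at r)"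
      using b(2)[OF cv _ _ r] unfolding B_def by simp
    ultimately show "\<exists>y. DERIV B r :> y \<and> 0 \<le> y" by blast
  qed
qed

text \<open>
  Away from the axis the logarithmic derivative of the weight is bounded by a multiple of \<open>1 /
  \<bar>b\<bar>\<close>. The average \<open>A\<close> therefore satisfies \<open>A' \<ge> - k *
  A\<close> with \<open>k = 4 * lam / \<bar>b\<bar>\<close>, and on the range \<open>r \<le>
  \<bar>b\<bar> / 2\<close> the resulting loss \<open>exp (k * r)\<close> is at most \<open>exp (2 *
  lam)\<close>.
\<close>
lemma off_axis_average:
  assumes R: "2 * R < 1 - norm (Complex a b)" and R0: "0 \<le> R" and Rb: "R \<le> \<bar>b\<bar> / 2" and b: "b \<noteq> 0"
  defines "A \<equiv> \<lambda>r. integral (cbox (-1,-1) (1,1))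
       (\<lambda>(x, y). u (Complex (a + r * x) (b + r * y)) * bump x y * axis_weight lam (b + r * y))"
  shows "A 0 \<le> exp (2 * lam) * A R"
proof -
  let ?v = "\<lambda>r y. axis_weight lam (b + r * y)"
  let ?v' = "\<lambda>r y. 2 * lam / (b + r * y) * axis_weight lam (b + r * y) * y"
  define k where "k = 4 * lam / \<bar>b\<bar>"
  have big: "\<bar>b\<bar> / 2 \<le> \<bar>b + r * y\<bar>" if "r \<in> {0..R}" "y \<in> {-1..1}" for r y
  proof -
    have "\<bar>r * y\<bar> \<le> R * 1" unfolding abs_mult using that by (intro mult_mono) auto
    then show ?thesis using Rb by linarith
  qed
  have ne: "b + r * y \<noteq> 0" if "r \<in> {0..R}" "y \<in> {-1..1}" for r y
    using big[OF that] b by auto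
  have cv: "continuous_on ({0..R} \<times> {-1..1}) (\<lambda>(r, y). ?v r y)"
    unfolding case_prod_unfold by (intro continuous_intros lam)
  have cv': "continuous_on ({0..R} \<times> {-1..1}) (\<lambda>(r, y). ?v' r y)"
    unfolding case_prod_unfold by (intro continuous_intros lam) (use ne in auto)
  have dv: "((\<lambda>r. ?v r y) has_real_derivative ?v' r y) (at r)" if "r \<in> {0<..<R}" "y \<in> {-1..1}" for r y
  proof (rule DERIV_chain2[OF has_real_derivative_axis_weight])
    show "b + r * y \<noteq> 0" using ne that by auto
    show "((\<lambda>r. b + r * y) has_real_derivative y) (at r)" by (auto intro!: derivative_eq_intros)
  qed
  note av = bump_average[OF R cv cv']
  have cA: "continuous_on {0..R} A"
    unfolding A_def by (rule av(1)) (rule dv)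
  have "exp (k * 0) * A 0 \<le> exp (k * R) * A R"
  proof (rule DERIV_nonneg_imp_increasing_open[OF R0])
    show "continuous_on {0..R} (\<lambda>r. exp (k * r) * A r)"
      by (intro continuous_intros cA)
    fix r assume "0 < r" "r < R"
    then have r: "r \<in> {0<..<R}" by auto
    let ?p = "\<lambda>x y. Complex (a + r * x) (b + r * y)"
    let ?g = "\<lambda>(x, y). (x * ux (?p x y) + y * uy (?p x y)) * bump x y * ?v r y"
    let ?h = "\<lambda>(x, y). u (?p x y) * bump x y * ?v' r y"
    let ?f = "\<lambda>(x, y). u (?p x y) * bump x y * ?v r y"
    note cs = continuous_on_scaled[OF _ R, where f="\<lambda>_. r"]
    have cg: "continuous_on (cbox (-1,-1) (1,1)) ?g"
      unfolding case_prod_unfold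
      by (intro continuous_intros cs cont_ux cont_uy lam) (use r in \<open>auto simp: cbox_Pair_eq\<close>)
    have cf: "continuous_on (cbox (-1,-1) (1,1)) ?f"
      unfolding case_prod_unfold
      by (intro continuous_intros cs continuous_on_u lam) (use r in \<open>auto simp: cbox_Pair_eq\<close>)
    have ch: "continuous_on (cbox (-1,-1) (1,1)) ?h"
      unfolding case_prod_unfold
      by (intro continuous_intros cs continuous_on_u lam) (use r ne in \<open>auto simp: cbox_Pair_eq\<close>)
    note int = integrable_continuous[OF cg] integrable_continuous[OF cf] integrable_continuous[OF ch]
    have 1: "0 \<le> integral (cbox (-1,-1) (1,1)) ?g"
      by (rule flux_nonneg; (rule square_in_disk)?) (use r R in auto)
    have "0 \<le> integral (cbox (-1,-1) (1,1)) (\<lambda>q. ?h q + k * ?f q)"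
    proof (rule integral_nonneg)
      show "(\<lambda>q. ?h q + k * ?f q) integrable_on cbox (-1,-1) (1,1)"
        by (intro integrable_add int integrable_on_mult_right)
      fix q :: "real \<times> real" assume q: "q \<in> cbox (-1,-1) (1,1)"
      obtain x y where [simp]: "q = (x, y)" by (cases q)
      have xy: "x \<in> {-1..1}" "y \<in> {-1..1}" using q by (auto simp: cbox_Pair_eq)
      have "\<bar>2 * lam / (b + r * y) * y\<bar> = 2 * lam * \<bar>y\<bar> / \<bar>b + r * y\<bar>"
        using lam by (simp add: abs_mult)
      also have "\<dots> \<le> 2 * lam * 1 / (\<bar>b\<bar> / 2)"
        using big[of r y] r xy lam b by (intro frac_le mult_mono) auto
      also have "\<dots> = k" by (simp add: k_def)
      finally have "0 \<le> 2 * lam / (b + r * y) * y + k" by linarith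
      then have "0 \<le> (u (?p x y) * bump x y * ?v r y) * (2 * lam / (b + r * y) * y + k)"
        using nonneg[OF square_in_disk[OF _ _ xy, of r a b]] r R bump_nonneg axis_weight_nonneg
        by (intro mult_nonneg_nonneg) auto
      then show "0 \<le> ?h q + k * ?f q" by (simp add: algebra_simps)
    qed
    also have "\<dots> = integral (cbox (-1,-1) (1,1)) ?h + k * integral (cbox (-1,-1) (1,1)) ?f"
      using integral_add[OF int(3) integrable_on_mult_right[OF int(2), of k]] by simp
    finally have 2: "0 \<le> integral (cbox (-1,-1) (1,1)) ?h + k * A r"
      by (simp add: A_def)
    have "(A has_real_derivative integral (cbox (-1,-1) (1,1)) (\<lambda>q. ?g q + ?h q)) (at r)"
      using av(2)[OF _ r, OF dv] unfolding A_def by (simp add: case_prod_unfold)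
    also have "integral (cbox (-1,-1) (1,1)) (\<lambda>q. ?g q + ?h q)
       = integral (cbox (-1,-1) (1,1)) ?g + integral (cbox (-1,-1) (1,1)) ?h"
      by (intro integral_add int)
    finally have dA: "(A has_real_derivative integral (cbox (-1,-1) (1,1)) ?g + integral (cbox (-1,-1) (1,1)) ?h) (at r)" .
    have de: "((\<lambda>r. exp (k * r)) has_real_derivative k * exp (k * r)) (at r)"
      by (auto intro!: derivative_eq_intros)
    have "0 \<le> exp (k * r) * (integral (cbox (-1,-1) (1,1)) ?g + (integral (cbox (-1,-1) (1,1)) ?h + k * A r))"
      using 1 2 by (intro mult_nonneg_nonneg) auto
    then show "\<exists>y. DERIV (\<lambda>r. exp (k * r) * A r) r :> y \<and> 0 \<le> y"
      using DERIV_mult[OF de dA] by (auto simp: algebra_simps intro!: exI)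
  qed
  moreover have "k * R \<le> 2 * lam"
    using mult_left_mono[OF Rb, of k] lam b by (simp add: k_def)
  moreover have "0 \<le> A R"
    unfolding A_def
  proof (rule integral_nonneg)
    show "(\<lambda>(x, y). u (Complex (a + R * x) (b + R * y)) * bump x y * axis_weight lam (b + R * y))
      integrable_on cbox (-1,-1) (1,1)"
      unfolding case_prod_unfold
      by (intro integrable_continuous continuous_intros continuous_on_scaled[OF _ R] continuous_on_u lam)
         (use R0 in \<open>auto simp: cbox_Pair_eq\<close>)
    fix q :: "real \<times> real" assume q: "q \<in> cbox (-1,-1) (1,1)"
    obtain x y where [simp]: "q = (x, y)" by (cases q)
    have xy: "x \<in> {-1..1}" "y \<in> {-1..1}" using q by (auto simp: cbox_Pair_eq)
    show "0 \<le> (case q of (x, y) \<Rightarrow> u (Complex (a + R * x) (b + R * y)) * bump x y * axis_weight lam (b + R * y))"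
      using nonneg[OF square_in_disk[OF R0 R xy]] bump_nonneg axis_weight_nonneg by simp
  qed
  ultimately show ?thesis
    using mult_right_mono[of "exp (k * R)" "exp (2 * lam)" "A R"] by simp
qed

end

section \<open>The mean value inequality\<close>

lemma lborel_complex_eq_distr:
  "distr lborel borel (\<lambda>p :: real \<times> real. Complex (fst p) (snd p)) = lborel"
proof (rule lborel_eqI[symmetric])
  have m: "(\<lambda>p :: real \<times> real. Complex (fst p) (snd p)) \<in> borel_measurable borel"
    by (intro borel_measurable_continuous_onI continuous_intros)
  fix l u :: complex assume le: "\<And>b. b \<in> Basis \<Longrightarrow> l \<bullet> b \<le> u \<bullet> b"
  have "(\<lambda>p :: real \<times> real. Complex (fst p) (snd p)) -` box l u = box (Re l, Im l) (Re u, Im u)"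
    by (auto simp: box_def Basis_complex_def Basis_prod_def)
  moreover have "Re l \<le> Re u" "Im l \<le> Im u"
    using le[of 1] le[of \<i>] by (auto simp: Basis_complex_def)
  ultimately show "emeasure (distr lborel borel (\<lambda>p :: real \<times> real. Complex (fst p) (snd p))) (box l u)
      = (\<Prod>b\<in>Basis. (u - l) \<bullet> b)"
    using m by (simp add: emeasure_distr emeasure_lborel_box_eq Basis_complex_def Basis_prod_def
        prod.union_disjoint ball_Un prod.insert_if image_iff)
qed simp

lemma nn_integral_complex_scaled:
  fixes F :: "complex \<Rightarrow> ennreal"
  assumes F: "F \<in> borel_measurable borel" and r: "0 < r"
  shows "(\<integral>\<^sup>+ w. F w \<partial>lborel) =
     ennreal (r\<^sup>2) * (\<integral>\<^sup>+ p. F (Complex (a + r * fst p) (b + r * snd p)) \<partial>lborel)"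
proof -
  have m: "(\<lambda>p :: real \<times> real. Complex (fst p) (snd p)) \<in> borel_measurable borel"
    by (intro borel_measurable_continuous_onI continuous_intros)
  have m2: "(\<lambda>z. Complex a b + r *\<^sub>R z) \<in> borel_measurable borel"
    by (intro borel_measurable_continuous_onI continuous_intros)
  have F2: "(\<lambda>z. F (Complex a b + r *\<^sub>R z)) \<in> borel_measurable borel"
    using measurable_compose[OF m2 F] by simp
  have "(\<integral>\<^sup>+ w. F w \<partial>lborel) =
      (\<integral>\<^sup>+ w. F w \<partial>density (distr lborel borel (\<lambda>z. Complex a b + r *\<^sub>R z)) (\<lambda>_. ennreal (\<bar>r\<bar> ^ DIM(complex))))"
    using r by (subst lborel_affine[of r "Complex a b"]) auto
  also have "\<dots> = ennreal (r\<^sup>2) * (\<integral>\<^sup>+ w. F w \<partial>distr lborel borel (\<lambda>z. Complex a b + r *\<^sub>R z))"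
    using F r by (subst nn_integral_density) (auto simp: nn_integral_cmult)
  also have "(\<integral>\<^sup>+ w. F w \<partial>distr lborel borel (\<lambda>z. Complex a b + r *\<^sub>R z))
     = (\<integral>\<^sup>+ z. F (Complex a b + r *\<^sub>R z) \<partial>lborel)"
    using F m2 by (simp add: nn_integral_distr)
  also have "\<dots> = (\<integral>\<^sup>+ z. F (Complex a b + r *\<^sub>R z)
      \<partial>distr lborel borel (\<lambda>p :: real \<times> real. Complex (fst p) (snd p)))"
    by (simp add: lborel_complex_eq_distr)
  also have "\<dots> = (\<integral>\<^sup>+ p. F (Complex a b + r *\<^sub>R Complex (fst p) (snd p)) \<partial>lborel)"
    using F2 m by (subst nn_integral_distr) auto
  also have "(\<lambda>p. Complex a b + r *\<^sub>R Complex (fst p) (snd p)) = (\<lambda>p. Complex (a + r * fst p) (b + r * snd p))"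
    by (auto simp: complex_eq_iff)
  then have "(\<integral>\<^sup>+ p. F (Complex a b + r *\<^sub>R Complex (fst p) (snd p)) \<partial>lborel)
     = (\<integral>\<^sup>+ p. F (Complex (a + r * fst p) (b + r * snd p)) \<partial>lborel)"
    by (metis (no_types))
  finally show ?thesis .
qed

lemma measurable_ennreal_indicator:
  fixes f :: "complex \<Rightarrow> real"
  assumes "open S" "continuous_on S f"
  shows "(\<lambda>w. ennreal (f w) * indicator S w) \<in> borel_measurable borel"
proof -
  have "(\<lambda>w. indicator S w *\<^sub>R f w) \<in> borel_measurable borel"
    using assms by (intro borel_measurable_continuous_on_indicator) auto
  then have "(\<lambda>w. ennreal (indicator S w *\<^sub>R f w)) \<in> borel_measurable borel"
    by measurable
  moreover have "(\<lambda>w. ennreal (indicator S w *\<^sub>R f w)) = (\<lambda>w. ennreal (f w) * indicator S w)"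
    by (auto simp: indicator_def)
  ultimately show ?thesis by simp
qed

definition weighted_mass :: "real \<Rightarrow> (complex \<Rightarrow> real) \<Rightarrow> complex \<Rightarrow> real \<Rightarrow> ennreal" where
  "weighted_mass lam u z r = (\<integral>\<^sup>+ w\<in>ball z r. ennreal (u w * axis_weight lam (Im w)) \<partial>lborel)"

context weighted_subsolution
begin

abbreviation "mass \<equiv> weighted_mass lam u"

lemma mass_mono: "ball z r \<subseteq> ball z' r' \<Longrightarrow> mass z r \<le> mass z' r'"
  unfolding weighted_mass_def by (intro nn_integral_mono) (auto simp: indicator_def)

definition average :: "complex \<Rightarrow> real \<Rightarrow> real" where
  "average z r = integral (cbox (-1,-1) (1,1)) (\<lambda>(x, y). u (Complex (Re z + r * x) (Im z + r * y))
      * bump x y * axis_weight lam (Im z + r * y))"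

lemma average_has_nn_integral:
  assumes r: "0 \<le> r" "2 * r < 1 - norm z"
  shows "(\<integral>\<^sup>+ p. ennreal (case p of (x, y) \<Rightarrow> u (Complex (Re z + r * x) (Im z + r * y))
      * bump x y * axis_weight lam (Im z + r * y)) * indicator (cbox (-1,-1) (1,1)) p \<partial>lborel) = ennreal (average z r)"
proof (rule nn_integral_has_integral_lebesgue')
  let ?g = "\<lambda>(x, y). u (Complex (Re z + r * x) (Im z + r * y)) * bump x y * axis_weight lam (Im z + r * y)"
  have r': "2 * r < 1 - norm (Complex (Re z) (Im z))" using r by simp
  show "0 \<le> ?g q" if q: "q \<in> cbox (-1,-1) (1,1)" for q
  proof -
    obtain x y where [simp]: "q = (x, y)" by (cases q)
    have xy: "x \<in> {-1..1}" "y \<in> {-1..1}" using q by (auto simp: cbox_Pair_eq)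
    show ?thesis
      using nonneg[OF square_in_disk[OF r(1) r' xy]] bump_nonneg axis_weight_nonneg by simp
  qed
  have "continuous_on (cbox (-1,-1) (1,1)) ?g"
    unfolding case_prod_unfold
    by (intro continuous_intros continuous_on_scaled[OF _ r'] continuous_on_u lam)
       (use r in \<open>auto simp: cbox_Pair_eq\<close>)
  then show "(?g has_integral average z r) (cbox (-1,-1) (1,1))"
    unfolding average_def by (intro integrable_integral integrable_continuous)
qed

lemma ball_in_disk:
  assumes "2 * r < 1 - norm z" "0 < r" shows "ball z r \<subseteq> ball 0 1"
proof
  fix w assume "w \<in> ball z r"
  then have "norm (w - z) < r" by (simp add: dist_norm norm_minus_commute)
  then show "w \<in> ball 0 1" using assms norm_triangle_ineq2[of w z] by simp
qed

lemma mass_measurable: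
  assumes "S \<subseteq> ball 0 1" "open S"
  shows "(\<lambda>w. ennreal (u w * axis_weight lam (Im w)) * indicator S w) \<in> borel_measurable borel"
  by (intro measurable_ennreal_indicator continuous_intros lam continuous_on_subset[OF continuous_on_u] assms)

lemma in_ball_scaled_iff:
  assumes "0 < r"
  shows "Complex (Re z + r * x) (Im z + r * y) \<in> ball z (r * s) \<longleftrightarrow> sqrt (x\<^sup>2 + y\<^sup>2) < s"
proof -
  have "Complex (Re z + r * x) (Im z + r * y) = z + of_real r * Complex x y"
    by (simp add: complex_eq_iff)
  then have "dist z (Complex (Re z + r * x) (Im z + r * y)) = r * sqrt (x\<^sup>2 + y\<^sup>2)"
    using assms by (simp add: dist_norm norm_mult complex_norm)
  then show ?thesis using assms by simp
qed

text \<open>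
  The averages are smoothed; this bound and the next one compare them with the sharp integral over a
  disk, using \<open>bump \<le> 1\<close> on the unit disk and \<open>bump \<ge> 3 / 4\<close> on the
  disk of radius \<open>1 / 2\<close>. The upper bound \<open>N\<close> on the possibly infinite
  integral keeps the later arithmetic in the reals.
\<close>
lemma average_le_mass:
  assumes r: "0 < r" "2 * r < 1 - norm z" and N: "0 \<le> N" "mass z r \<le> ennreal N"
  shows "r\<^sup>2 * average z r \<le> N"
proof -
  let ?p = "\<lambda>x y. Complex (Re z + r * x) (Im z + r * y)"
  let ?F = "\<lambda>w. ennreal (u w * axis_weight lam (Im w)) * indicator (ball z r) w"
  have r': "2 * r < 1 - norm (Complex (Re z) (Im z))" using r by simp
  have le: "ennreal (average z r) \<le> (\<integral>\<^sup>+ p. ?F (?p (fst p) (snd p)) \<partial>lborel)"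
    unfolding average_has_nn_integral[OF less_imp_le[OF r(1)] r(2), symmetric]
  proof (intro nn_integral_mono)
    fix q :: "real \<times> real"
    obtain x y where [simp]: "q = (x, y)" by (cases q)
    show "ennreal (case q of (x, y) \<Rightarrow> u (?p x y) * bump x y * axis_weight lam (Im z + r * y))
       * indicator (cbox (-1,-1) (1,1)) q \<le> ?F (?p (fst q) (snd q))"
    proof (cases "q \<in> cbox (-1,-1) (1,1) \<and> bump x y \<noteq> 0")
      case True
      then have xy: "x \<in> {-1..1}" "y \<in> {-1..1}" by (auto simp: cbox_Pair_eq)
      have "sqrt (x\<^sup>2 + y\<^sup>2) < 1" using True by (auto simp: bump_def max_def split: if_splits)
      then have "?p x y \<in> ball z r" using in_ball_scaled_iff[OF r(1), of z x y 1] by simp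
      moreover have "bump x y \<le> 1" by (simp add: bump_def)
      moreover have "0 \<le> u (?p x y) * axis_weight lam (Im z + r * y)"
        using nonneg[OF square_in_disk[OF _ r' xy]] r axis_weight_nonneg by simp
      ultimately show ?thesis
        using mult_left_mono[of "bump x y" 1 "u (?p x y) * axis_weight lam (Im z + r * y)"]
        by (auto simp: indicator_def mult_ac intro!: ennreal_leI)
    qed (auto simp: indicator_def)
  qed
  have "ennreal (r\<^sup>2 * average z r) = ennreal (r\<^sup>2) * ennreal (average z r)"
    by (rule ennreal_mult') simp
  also have "\<dots> \<le> ennreal (r\<^sup>2) * (\<integral>\<^sup>+ p. ?F (?p (fst p) (snd p)) \<partial>lborel)"
    by (rule mult_left_mono[OF le]) simp
  also have "\<dots> = mass z r"
    unfolding weighted_mass_def using nn_integral_complex_scaled[OF mass_measurable r(1)]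
      ball_in_disk[OF r(2,1)] by simp
  also have "\<dots> \<le> ennreal N" by (rule N)
  finally show ?thesis using N(1) by (simp only: ennreal_le_iff)
qed

lemma mass_le_average:
  assumes r: "0 < r" "2 * r < 1 - norm z"
  shows "mass z (r / 2) \<le> ennreal (4 / 3 * r\<^sup>2 * average z r)"
proof -
  let ?p = "\<lambda>x y. Complex (Re z + r * x) (Im z + r * y)"
  let ?F = "\<lambda>w. ennreal (u w * axis_weight lam (Im w)) * indicator (ball z (r / 2)) w"
  let ?G = "\<lambda>q. ennreal (case q of (x, y) \<Rightarrow> u (?p x y) * bump x y * axis_weight lam (Im z + r * y))
       * indicator (cbox (-1,-1) (1,1)) q"
  have r': "2 * r < 1 - norm (Complex (Re z) (Im z))" using r by simp
  have c: "continuous_on (cbox (-1,-1) (1,1)) (\<lambda>(x, y). u (?p x y) * bump x y * axis_weight lam (Im z + r * y))"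
    unfolding case_prod_unfold
    by (intro continuous_intros continuous_on_scaled[OF _ r'] continuous_on_u lam)
       (use r in \<open>auto simp: cbox_Pair_eq\<close>)
  have "(\<lambda>q. indicator (cbox (-1,-1) (1,1)) q *\<^sub>R
       (case q of (x, y) \<Rightarrow> u (?p x y) * bump x y * axis_weight lam (Im z + r * y))) \<in> borel_measurable borel"
    by (intro borel_measurable_continuous_on_indicator c) auto
  then have "(\<lambda>q. ennreal (indicator (cbox (-1,-1) (1,1)) q *\<^sub>R
       (case q of (x, y) \<Rightarrow> u (?p x y) * bump x y * axis_weight lam (Im z + r * y)))) \<in> borel_measurable borel"
    by measurable
  moreover have "(\<lambda>q. ennreal (indicator (cbox (-1,-1) (1,1)) q *\<^sub>R
       (case q of (x, y) \<Rightarrow> u (?p x y) * bump x y * axis_weight lam (Im z + r * y)))) = ?G"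
    by (auto simp: indicator_def fun_eq_iff)
  ultimately have G: "?G \<in> borel_measurable borel" by simp
  have eq: "mass z (r / 2) = ennreal (r\<^sup>2) * (\<integral>\<^sup>+ p. ?F (?p (fst p) (snd p)) \<partial>lborel)"
    unfolding weighted_mass_def
    using nn_integral_complex_scaled[OF mass_measurable r(1)] ball_in_disk[of "r / 2" z] r by simp
  have "(\<integral>\<^sup>+ p. ?F (?p (fst p) (snd p)) \<partial>lborel) \<le> (\<integral>\<^sup>+ q. ennreal (4 / 3) * ?G q \<partial>lborel)"
  proof (intro nn_integral_mono)
    fix q :: "real \<times> real"
    obtain x y where [simp]: "q = (x, y)" by (cases q)
    show "?F (?p (fst q) (snd q)) \<le> ennreal (4 / 3) * ?G q"
    proof (cases "?p x y \<in> ball z (r / 2)")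
      case True
      then have s: "sqrt (x\<^sup>2 + y\<^sup>2) < 1 / 2" using in_ball_scaled_iff[OF r(1), of z x y "1/2"] by simp
      have "(sqrt (x\<^sup>2 + y\<^sup>2))\<^sup>2 < (1 / 2)\<^sup>2" by (rule power_strict_mono[OF s]) auto
      then have s2: "x\<^sup>2 + y\<^sup>2 < 1 / 4" by (simp add: power2_eq_square)
      have "\<bar>x\<bar> \<le> sqrt (x\<^sup>2 + y\<^sup>2)" "\<bar>y\<bar> \<le> sqrt (x\<^sup>2 + y\<^sup>2)" by simp_all
      then have "\<bar>x\<bar> \<le> 1" "\<bar>y\<bar> \<le> 1" using s by linarith+
      then have xy: "x \<in> {-1..1}" "y \<in> {-1..1}" by auto
      have nn: "0 \<le> u (?p x y) * axis_weight lam (Im z + r * y)"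
        using nonneg[OF square_in_disk[OF _ r' xy]] r axis_weight_nonneg by simp
      have "1 \<le> 4 / 3 * bump x y" using s2 by (simp add: bump_def)
      from mult_left_mono[OF this nn]
      have "u (?p x y) * axis_weight lam (Im z + r * y)
          \<le> 4 / 3 * (u (?p x y) * bump x y * axis_weight lam (Im z + r * y))"
        by (simp add: mult_ac)
      then show ?thesis
        using True xy
        by (simp add: indicator_def cbox_Pair_eq ennreal_mult'[symmetric] ennreal_leI del: mem_ball)
    qed (auto simp: indicator_def)
  qed
  also have "\<dots> = ennreal (4 / 3) * ennreal (average z r)"
    using G by (subst nn_integral_cmult) (simp_all only: average_has_nn_integral[OF less_imp_le[OF r(1)] r(2)] measurable_lborel2)
  finally have "mass z (r / 2) \<le> ennreal (r\<^sup>2) * (ennreal (4 / 3) * ennreal (average z r))"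
    unfolding eq by (rule mult_left_mono) simp
  also have "\<dots> = ennreal (r\<^sup>2 * (4 / 3 * average z r))"
    by (simp only: ennreal_mult'[of "4 / 3" "average z r", symmetric]
        ennreal_mult'[of "r\<^sup>2" "4 / 3 * average z r", symmetric] zero_le_power2 zero_le_divide_iff zero_le_numeral simp_thms)
  finally show ?thesis
    by (simp only: mult.commute mult.left_commute mult.assoc)
qed

end

context weighted_subsolution
begin

lemma off_axis_mean_value:
  assumes R: "0 < R" "2 * R < 1 - norm z" "R \<le> \<bar>Im z\<bar> / 2"
    and N: "0 \<le> N" "mass z R \<le> ennreal N"
  shows "u z * axis_weight lam (Im z) * integral (cbox (-1,-1) (1,1)) (\<lambda>(x, y). bump x y) * R\<^sup>2
    \<le> exp (2 * lam) * N"
proof -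
  have "average z 0 = integral (cbox (-1,-1) (1,1)) (\<lambda>p. (u z * axis_weight lam (Im z)) * (case p of (x, y) \<Rightarrow> bump x y))"
    unfolding average_def by (intro integral_cong) (auto simp: mult_ac)
  then have "average z 0 = u z * axis_weight lam (Im z) * integral (cbox (-1,-1) (1,1)) (\<lambda>(x, y). bump x y)"
    by simp
  moreover have "average z 0 \<le> exp (2 * lam) * average z R"
    unfolding average_def by (rule off_axis_average) (use R in auto)
  ultimately have "u z * axis_weight lam (Im z) * integral (cbox (-1,-1) (1,1)) (\<lambda>(x, y). bump x y) * R\<^sup>2
     \<le> exp (2 * lam) * average z R * R\<^sup>2"
    by (intro mult_right_mono) auto
  also have "\<dots> = exp (2 * lam) * (R\<^sup>2 * average z R)" by simp
  also have "\<dots> \<le> exp (2 * lam) * N"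
    by (intro mult_left_mono average_le_mass R N) auto
  finally show ?thesis .
qed

definition axis_average :: "real \<Rightarrow> real \<Rightarrow> real" where
  "axis_average a r = integral (cbox (-1,-1) (1,1))
     (\<lambda>(x, y). u (Complex (a + r * x) (0 + r * y)) * bump x y * axis_weight lam y)"

lemma average_on_axis: "average (Complex a 0) r = axis_weight lam r * axis_average a r"
proof -
  have "average (Complex a 0) r = integral (cbox (-1,-1) (1,1))
     (\<lambda>p. axis_weight lam r * (case p of (x, y) \<Rightarrow> u (Complex (a + r * x) (0 + r * y)) * bump x y * axis_weight lam y))"
    unfolding average_def by (intro integral_cong) (auto simp: axis_weight_mult)
  then show ?thesis unfolding axis_average_def by simp
qed

lemma axis_average_le_mass:
  assumes R: "0 < R" "2 * R < 1 - \<bar>a\<bar>" and N: "0 \<le> N" "mass (Complex a 0) R \<le> ennreal N"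
  shows "axis_average a R \<le> N / (R\<^sup>2 * axis_weight lam R)"
proof -
  have "R\<^sup>2 * average (Complex a 0) R \<le> N"
    by (rule average_le_mass) (use R N in \<open>auto simp: complex_norm\<close>)
  then show ?thesis
    using R axis_weight_pos[of R lam] by (simp add: average_on_axis field_simps)
qed

text \<open>
  The integral over a small disk about a real point is controlled by the one over a large disk, with the
  factor that scaling predicts. This is where monotonicity of the averages about real points is used for
  two positive radii.
\<close>
lemma mass_le_axis_average:
  assumes R: "0 < s" "s \<le> R" "2 * R < 1 - \<bar>a\<bar>" and N: "0 \<le> N" "mass (Complex a 0) R \<le> ennreal N"
  shows "mass (Complex a 0) (s / 2)
    \<le> ennreal (4 / 3 * s\<^sup>2 * axis_weight lam s * (N / (R\<^sup>2 * axis_weight lam R)))"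
proof -
  have "mass (Complex a 0) (s / 2) \<le> ennreal (4 / 3 * s\<^sup>2 * average (Complex a 0) s)"
    by (rule mass_le_average) (use R in \<open>auto simp: complex_norm\<close>)
  also have "\<dots> = ennreal (4 / 3 * s\<^sup>2 * axis_weight lam s * axis_average a s)"
    by (simp add: average_on_axis mult.assoc)
  also have "\<dots> \<le> ennreal (4 / 3 * s\<^sup>2 * axis_weight lam s * (N / (R\<^sup>2 * axis_weight lam R)))"
  proof (intro ennreal_leI mult_left_mono)
    have "axis_average a s \<le> axis_average a R"
      unfolding axis_average_def by (rule axis_average_mono) (use R in auto)
    also have "\<dots> \<le> N / (R\<^sup>2 * axis_weight lam R)"
      by (rule axis_average_le_mass) (use R N in auto)
    finally show "axis_average a s \<le> N / (R\<^sup>2 * axis_weight lam R)" .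
  qed (simp add: axis_weight_nonneg)
  finally show ?thesis .
qed

lemma on_axis_mean_value:
  assumes R: "0 < R" "2 * R < 1 - \<bar>a\<bar>" and N: "0 \<le> N" "mass (Complex a 0) R \<le> ennreal N"
  shows "u (Complex a 0) * integral (cbox (-1,-1) (1,1)) (\<lambda>(x, y). bump x y * axis_weight lam y)
          \<le> N / (R\<^sup>2 * axis_weight lam R)"
proof -
  have "axis_average a 0 = integral (cbox (-1,-1) (1,1)) (\<lambda>p. u (Complex a 0) * (case p of (x, y) \<Rightarrow> bump x y * axis_weight lam y))"
    unfolding axis_average_def by (intro integral_cong) (auto simp: mult_ac)
  then have "axis_average a 0 = u (Complex a 0) * integral (cbox (-1,-1) (1,1)) (\<lambda>(x, y). bump x y * axis_weight lam y)"
    by simp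
  also have "axis_average a 0 \<le> axis_average a R"
    unfolding axis_average_def by (rule axis_average_mono) (use R in auto)
  ultimately show ?thesis
    using axis_average_le_mass[OF assms] by linarith
qed

end

text \<open>
  The three summands are the constants of the three cases in the proof of the mean value inequality:
  distance to the axis comparable to the radius, positive but much smaller, and zero.
\<close>
definition mean_value_const :: "real \<Rightarrow> real" where
  "mean_value_const lam =
     (let K = integral (cbox (-1,-1) (1,1)) (\<lambda>(x, y). bump x y);
          K' = integral (cbox (-1,-1) (1,1)) (\<lambda>(x, y). bump x y * axis_weight lam y)
      in exp (2 * lam) * 256 * axis_weight lam 9 / K
         + exp (2 * lam) * (1024 / 3) * axis_weight lam 4 * axis_weight lam 2 / (axis_weight lam (1/2) * K)
         + 1 / K')"

lemma mean_value_const_pos: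
  assumes "0 \<le> lam" shows "0 < mean_value_const lam"
proof -
  have "0 < integral (cbox (-1,-1) (1,1)) (\<lambda>(x, y). bump x y)"
    using bump_integral_pos[of 0] by (simp add: axis_weight_def)
  then show ?thesis
    unfolding mean_value_const_def Let_def
    using bump_integral_pos[OF assms] axis_weight_pos[of _ lam]
    by (intro add_pos_pos divide_pos_pos mult_pos_pos) auto
qed

text \<open>
  The factor on the left is comparable to the weighted area of the disk of radius \<open>r\<close> about
  \<open>z\<close>, uniformly in the position of \<open>z\<close> relative to the axis; this uniformity
  is the point of the lemma.
\<close>
lemma (in weighted_subsolution) mean_value_inequality:
  assumes r: "0 < r" "2 * r < 1 - norm z"
    and N: "0 \<le> N" "mass z r \<le> ennreal N"
  shows "u z * (r\<^sup>2 * axis_weight lam (\<bar>Im z\<bar> + r)) \<le> mean_value_const lam * N"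
proof -
  define K where "K = integral (cbox (-1,-1) (1,1)) (\<lambda>(x, y). bump x y)"
  define K' where "K' = integral (cbox (-1,-1) (1,1)) (\<lambda>(x, y). bump x y * axis_weight lam y)"
  define C1 where "C1 = exp (2 * lam) * 256 * axis_weight lam 9 / K"
  define C2 where "C2 = exp (2 * lam) * (1024 / 3) * axis_weight lam 4 * axis_weight lam 2 / (axis_weight lam (1/2) * K)"
  define C3 where "C3 = 1 / K'"
  have K: "0 < K"
    using bump_integral_pos[of 0] by (simp add: axis_weight_def K_def)
  have K': "0 < K'" using bump_integral_pos[OF lam] by (simp add: K'_def)
  note pos = axis_weight_pos[of _ lam]
  have C: "mean_value_const lam = C1 + C2 + C3" "0 < C1" "0 < C2" "0 < C3"
    using K K' pos by (auto simp: mean_value_const_def Let_def C1_def C2_def C3_def K_def K'_def)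
  define y where "y = \<bar>Im z\<bar>"
  have uz: "0 \<le> u z" using nonneg[of z] r by simp
  have wy: "axis_weight lam (Im z) = axis_weight lam y" by (simp add: y_def axis_weight_def)
  have y0: "0 \<le> y" by (simp add: y_def)
  have Re: "\<bar>Re z\<bar> \<le> norm z" by (rule abs_Re_le_cmod)
  consider "r / 8 \<le> y" | "0 < y" "y < r / 8" | "y = 0" using y0 by linarith
  then have "\<exists>C\<in>{C1, C2, C3}. u z * (r\<^sup>2 * axis_weight lam (y + r)) \<le> C * N"
  proof cases
    case 1
    have "mass z (r / 16) \<le> ennreal N"
      by (rule order_trans[OF mass_mono N(2)]) (use r in \<open>auto intro: subset_ball\<close>)
    then have "u z * axis_weight lam y * K * (r / 16)\<^sup>2 \<le> exp (2 * lam) * N"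
      using off_axis_mean_value[of "r / 16" z N] r 1 N(1) by (simp add: wy K_def y_def)
    then have *: "u z * axis_weight lam y * r\<^sup>2 \<le> exp (2 * lam) * N * 256 / K"
      using K by (simp add: field_simps power2_eq_square)
    have "axis_weight lam (y + r) \<le> axis_weight lam (9 * y)"
      by (rule axis_weight_mono[OF lam]) (use 1 r in auto)
    also have "\<dots> = axis_weight lam 9 * axis_weight lam y" by (rule axis_weight_mult)
    finally have "u z * (r\<^sup>2 * axis_weight lam (y + r)) \<le> u z * (r\<^sup>2 * (axis_weight lam 9 * axis_weight lam y))"
      using uz by (intro mult_left_mono) auto
    also have "\<dots> = axis_weight lam 9 * (u z * axis_weight lam y * r\<^sup>2)" by (simp add: mult_ac)
    also have "\<dots> \<le> axis_weight lam 9 * (exp (2 * lam) * N * 256 / K)"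
      by (rule mult_left_mono[OF * axis_weight_nonneg])
    also have "\<dots> = C1 * N" by (simp add: C1_def mult_ac)
    finally show ?thesis by blast
  next
    case 2
    \<comment> \<open>Pass from the disk of radius \<open>y / 2\<close> about \<open>z\<close> to the one of radius \<open>2 * y\<close> about \<open>Re z\<close>
      and then, by monotonicity between the scales \<open>s = 4 * y\<close> and \<open>R = r / 2\<close>, to a disk inside the
      one of radius \<open>r\<close> about \<open>z\<close>.\<close>
    define N' where "N' = 4 / 3 * (4 * y)\<^sup>2 * axis_weight lam (4 * y) * (N / ((r / 2)\<^sup>2 * axis_weight lam (r / 2)))"
    have N'0: "0 \<le> N'" using N axis_weight_nonneg by (simp add: N'_def)
    have dz: "dist (Complex (Re z) 0) z = y"
      by (simp add: dist_norm complex_norm y_def norm_complex_def)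
    have "ball (Complex (Re z) 0) (r / 2) \<subseteq> ball z r"
    proof
      fix w assume "w \<in> ball (Complex (Re z) 0) (r / 2)"
      then show "w \<in> ball z r"
        using dist_triangle[of z w "Complex (Re z) 0"] dz 2 by (simp add: dist_commute)
    qed
    from mass_mono[OF this] have m1: "mass (Complex (Re z) 0) (r / 2) \<le> ennreal N"
      using N(2) by simp
    have "mass (Complex (Re z) 0) (4 * y / 2) \<le> ennreal N'"
      unfolding N'_def by (rule mass_le_axis_average) (use r 2 N m1 Re in auto)
    moreover have "ball z (y / 2) \<subseteq> ball (Complex (Re z) 0) (4 * y / 2)"
    proof
      fix w assume "w \<in> ball z (y / 2)"
      then show "w \<in> ball (Complex (Re z) 0) (4 * y / 2)"
        using dist_triangle[of "Complex (Re z) 0" w z] dz 2 by (simp add: dist_commute)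
    qed
    ultimately have m2: "mass z (y / 2) \<le> ennreal N'"
      using mass_mono order_trans by blast
    have "u z * axis_weight lam y * K * (y / 2)\<^sup>2 \<le> exp (2 * lam) * N'"
      using off_axis_mean_value[of "y / 2" z N', OF _ _ _ N'0 m2] r 2 by (simp add: wy K_def y_def)
    also have "N' = (256 / 3) * y\<^sup>2 * axis_weight lam 4 * axis_weight lam y * N / (r\<^sup>2 * axis_weight lam (1/2) * axis_weight lam r)"
      using axis_weight_mult[of lam "1/2" r] unfolding N'_def axis_weight_mult[of lam 4 y]
      by (simp add: power2_eq_square field_simps)
    finally have *: "u z * r\<^sup>2 * axis_weight lam r \<le> exp (2 * lam) * (1024 / 3) * axis_weight lam 4 * N / (axis_weight lam (1/2) * K)"
    proof -
      assume "u z * axis_weight lam y * K * (y / 2)\<^sup>2 \<le> exp (2 * lam) *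
         ((256 / 3) * y\<^sup>2 * axis_weight lam 4 * axis_weight lam y * N / (r\<^sup>2 * axis_weight lam (1/2) * axis_weight lam r))"
      then have "(axis_weight lam y * y\<^sup>2) * (u z * K / 4) \<le> (axis_weight lam y * y\<^sup>2) *
         (exp (2 * lam) * (256 / 3) * axis_weight lam 4 * N / (r\<^sup>2 * axis_weight lam (1/2) * axis_weight lam r))"
        by (simp add: power2_eq_square field_simps)
      then have "u z * K / 4 \<le> exp (2 * lam) * (256 / 3) * axis_weight lam 4 * N / (r\<^sup>2 * axis_weight lam (1/2) * axis_weight lam r)"
        using 2 pos[of y] by (subst (asm) mult_le_cancel_left_pos) auto
      then show ?thesis
        using r pos[of r] pos[of "1/2"] K by (simp add: field_simps)
    qed
    have "axis_weight lam (y + r) \<le> axis_weight lam (2 * r)"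
      by (rule axis_weight_mono[OF lam]) (use 2 r in auto)
    also have "\<dots> = axis_weight lam 2 * axis_weight lam r" by (rule axis_weight_mult)
    finally have "u z * (r\<^sup>2 * axis_weight lam (y + r)) \<le> u z * (r\<^sup>2 * (axis_weight lam 2 * axis_weight lam r))"
      using uz by (intro mult_left_mono) auto
    also have "\<dots> = axis_weight lam 2 * (u z * r\<^sup>2 * axis_weight lam r)" by (simp add: mult_ac)
    also have "\<dots> \<le> axis_weight lam 2 * (exp (2 * lam) * (1024 / 3) * axis_weight lam 4 * N / (axis_weight lam (1/2) * K))"
      by (rule mult_left_mono[OF * axis_weight_nonneg])
    also have "\<dots> = C2 * N" by (simp add: C2_def mult_ac)
    finally show ?thesis by blast
  next
    case 3
    then have z: "z = Complex (Re z) 0" by (simp add: complex_eq_iff y_def)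
    have "u z * K' \<le> N / (r\<^sup>2 * axis_weight lam r)"
      using on_axis_mean_value[of r "Re z" N] r N Re z by (simp add: K'_def)
    then have "u z * (r\<^sup>2 * axis_weight lam (y + r)) \<le> C3 * N"
      using r K' pos[of r] 3 by (simp add: C3_def field_simps)
    then show ?thesis by blast
  qed
  moreover have "C * N \<le> mean_value_const lam * N" if "C \<in> {C1, C2, C3}" for C
    using that C N(1) by (intro mult_right_mono) auto
  ultimately show ?thesis unfolding y_def by (meson order_trans)
qed

section \<open>Mean value inequalities for powers\<close>

context weighted_subsolution
begin

text \<open>
  For every level \<open>s > 0\<close> the linear function is dominated by \<open>u \<le> s + s powr (1
  - q) * u powr q\<close>. Inserting this into the mean value inequality and balancing the two terms by
  the choice of \<open>s\<close> replaces an appeal to Jensen's inequality.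
\<close>
lemma power_mean_value_ge_1:
  assumes q: "1 \<le> q" and z: "z \<in> ball 0 1" and N: "0 < N"
    and int: "(\<integral>\<^sup>+ w\<in>ball 0 1. ennreal (u w powr q * axis_weight lam (Im w)) \<partial>lborel) \<le> ennreal N"
  shows "u z powr q * ((1 - norm z)\<^sup>2 * axis_weight lam (\<bar>Im z\<bar> + (1 - norm z)))
    \<le> (5 * mean_value_const lam) powr q * (16 * axis_weight lam 4) * N"
proof -
  define r where "r = (1 - norm z) / 4"
  have r: "0 < r" "2 * r < 1 - norm z" using z by (auto simp: r_def)
  define Y where "Y = \<bar>Im z\<bar> + r"
  have Y: "0 < Y" using r by (simp add: Y_def)
  define m where "m = r\<^sup>2 * axis_weight lam Y"
  have m: "0 < m" using r axis_weight_pos[of Y lam] Y by (simp add: m_def)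
  \<comment> \<open>At this level the two terms of the convexity bound are comparable: \<open>s powr (1 - q) * N = m * s\<close>.\<close>
  define s where "s = (N / m) powr (1 / q)"
  have s: "0 < s" using N m by (simp add: s_def)
  have sq: "s powr q = N / m" using q N m by (simp add: s_def powr_powr)
  have B: "ball z r \<subseteq> ball 0 1" by (rule ball_in_disk[OF r(2,1)])
  let ?G = "\<lambda>w. ennreal (u w powr q * axis_weight lam (Im w)) * indicator (ball z r) w"
  have mG: "?G \<in> borel_measurable borel"
    using q nonneg B
    by (intro measurable_ennreal_indicator continuous_intros continuous_on_powr' lam
          continuous_on_subset[OF continuous_on_u]) auto
  have mI: "(\<lambda>w. ennreal (s * axis_weight lam Y) * indicator (ball z r) w) \<in> borel_measurable borel"
    by (rule measurable_ennreal_indicator) auto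
  have "mass z r \<le> (\<integral>\<^sup>+ w. ennreal (s * axis_weight lam Y) * indicator (ball z r) w
      + ennreal (s powr (1 - q)) * ?G w \<partial>lborel)"
    unfolding weighted_mass_def
  proof (intro nn_integral_mono)
    fix w
    show "ennreal (u w * axis_weight lam (Im w)) * indicator (ball z r) w
      \<le> ennreal (s * axis_weight lam Y) * indicator (ball z r) w + ennreal (s powr (1 - q)) * ?G w"
    proof (cases "w \<in> ball z r")
      case True
      have uw: "0 \<le> u w" using True B nonneg by blast
      have "\<bar>Im w - Im z\<bar> < r"
        using abs_Im_le_cmod[of "w - z"] True by (simp add: dist_norm norm_minus_commute)
      then have wY: "axis_weight lam (Im w) \<le> axis_weight lam Y"
        by (intro axis_weight_mono lam) (auto simp: Y_def)
      have "u w \<le> s + s powr (1 - q) * u w powr q"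
      proof (cases "u w \<le> s")
        case False
        then have "s powr (q - 1) \<le> u w powr (q - 1)"
          using s q by (intro powr_mono2) auto
        then have "s powr (1 - q) * s powr (q - 1) * u w \<le> s powr (1 - q) * u w powr (q - 1) * u w"
          using uw by (intro mult_right_mono mult_left_mono) auto
        moreover have "s powr (1 - q) * s powr (q - 1) = 1"
          using s by (simp add: powr_add[symmetric])
        moreover have "u w powr (q - 1) * u w = u w powr q"
          using False s powr_add[of "u w" "q - 1" 1] by simp
        ultimately show ?thesis using s by (simp add: mult.assoc)
      qed (simp add: add_increasing2)
      then have "u w * axis_weight lam (Im w) \<le> (s + s powr (1 - q) * u w powr q) * axis_weight lam (Im w)"
        by (rule mult_right_mono[OF _ axis_weight_nonneg])
      also have "\<dots> \<le> s * axis_weight lam Y + s powr (1 - q) * (u w powr q * axis_weight lam (Im w))"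
        using mult_left_mono[OF wY, of s] s by (simp add: algebra_simps)
      finally have "ennreal (u w * axis_weight lam (Im w))
         \<le> ennreal (s * axis_weight lam Y + s powr (1 - q) * (u w powr q * axis_weight lam (Im w)))"
        by (rule ennreal_leI)
      also have "\<dots> = ennreal (s * axis_weight lam Y) + ennreal (s powr (1 - q)) * ennreal (u w powr q * axis_weight lam (Im w))"
        using s axis_weight_nonneg[of lam] by (simp add: ennreal_plus ennreal_mult')
      finally show ?thesis using True by simp
    qed simp
  qed
  also have "\<dots> = ennreal (s * axis_weight lam Y) * emeasure lborel (ball z r)
      + ennreal (s powr (1 - q)) * (\<integral>\<^sup>+ w. ?G w \<partial>lborel)"
    using mG mI by (simp add: nn_integral_add nn_integral_cmult nn_integral_cmult_indicator)
  also have "\<dots> \<le> ennreal (s * axis_weight lam Y) * ennreal (4 * r\<^sup>2) + ennreal (s powr (1 - q)) * ennreal N"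
  proof (intro add_mono mult_left_mono)
    have "emeasure lborel (ball z r) = ennreal (pi * r\<^sup>2)"
      using r by (simp add: emeasure_ball unit_ball_vol_2)
    also have "\<dots> \<le> ennreal (4 * r\<^sup>2)"
      using pi_less_4 by (intro ennreal_leI mult_right_mono) auto
    finally show "emeasure lborel (ball z r) \<le> ennreal (4 * r\<^sup>2)" .
    have "(\<integral>\<^sup>+ w. ?G w \<partial>lborel) \<le> (\<integral>\<^sup>+ w\<in>ball 0 1. ennreal (u w powr q * axis_weight lam (Im w)) \<partial>lborel)"
      using B by (intro nn_integral_mono) (auto simp: indicator_def)
    then show "(\<integral>\<^sup>+ w. ?G w \<partial>lborel) \<le> ennreal N" using int by (rule order_trans)
  qed auto
  also have "\<dots> = ennreal (4 * m * s + s powr (1 - q) * N)"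
    using s N axis_weight_nonneg[of lam Y]
    by (simp add: ennreal_plus ennreal_mult'[symmetric] m_def mult_ac)
  also have "4 * m * s + s powr (1 - q) * N = 5 * m * s"
  proof -
    have "s powr (1 - q) * N = s powr (1 - q) * s powr q * m" using sq m by simp
    also have "s powr (1 - q) * s powr q = s" using s by (simp add: powr_add[symmetric])
    finally show ?thesis by simp
  qed
  finally have "mass z r \<le> ennreal (5 * m * s)" .
  from mean_value_inequality[OF r _ this] have "u z * m \<le> mean_value_const lam * (5 * m * s)"
    using m s by (simp add: m_def Y_def)
  then have "u z * m \<le> (5 * mean_value_const lam * s) * m" by (simp add: mult_ac)
  then have "u z \<le> 5 * mean_value_const lam * s" using m by simp
  then have "u z powr q \<le> (5 * mean_value_const lam * s) powr q"
    using q nonneg[OF z] by (intro powr_mono2) auto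
  also have "\<dots> = (5 * mean_value_const lam) powr q * (N / m)"
    using sq s mean_value_const_pos[OF lam] by (simp add: powr_mult)
  finally have *: "u z powr q * m \<le> (5 * mean_value_const lam) powr q * N"
    using m by (simp add: field_simps)
  have r4: "1 - norm z = 4 * r" by (simp add: r_def)
  have "axis_weight lam (\<bar>Im z\<bar> + (1 - norm z)) \<le> axis_weight lam (4 * Y)"
    unfolding r4 using r(1) by (intro axis_weight_mono lam) (simp add: Y_def)
  then have "(1 - norm z)\<^sup>2 * axis_weight lam (\<bar>Im z\<bar> + (1 - norm z)) \<le> (4 * r)\<^sup>2 * (axis_weight lam 4 * axis_weight lam Y)"
    unfolding axis_weight_mult[symmetric] r4 by (rule mult_left_mono) simp
  also have "\<dots> = 16 * axis_weight lam 4 * m" by (simp add: m_def power2_eq_square)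
  finally have "u z powr q * ((1 - norm z)\<^sup>2 * axis_weight lam (\<bar>Im z\<bar> + (1 - norm z)))
     \<le> u z powr q * (16 * axis_weight lam 4 * m)"
    by (rule mult_left_mono) simp
  also have "\<dots> = 16 * axis_weight lam 4 * (u z powr q * m)" by (simp add: mult_ac)
  also have "\<dots> \<le> 16 * axis_weight lam 4 * ((5 * mean_value_const lam) powr q * N)"
    by (rule mult_left_mono[OF *]) (simp add: axis_weight_nonneg)
  finally show ?thesis by (simp add: mult_ac)
qed

text \<open>
  The Hardy--Littlewood device. On a closed disk of radius \<open>R\<close> strictly between
  \<open>\<bar>z\<bar>\<close> and \<open>1\<close> the continuous function \<open>u powr q * W\<close>
  attains its maximum, at \<open>z0\<close> say. On the disk about \<open>z0\<close> of half the
  distance to the boundary, \<open>W\<close> is at least a fixed fraction of \<open>W z0\<close>, so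
  there \<open>u\<close> is at most a constant times \<open>u z0\<close>. Writing \<open>u = u powr (1 -
  q) * u powr q\<close> in the mean value inequality at \<open>z0\<close> and cancelling \<open>u z0
  powr (1 - q)\<close> bounds the maximum by the integral of \<open>u powr q\<close>.
\<close>
lemma power_mean_value_less_1:
  assumes q: "0 < q" "q < 1" and z: "z \<in> ball 0 1" and N: "0 < N"
    and int: "(\<integral>\<^sup>+ w\<in>ball 0 1. ennreal (u w powr q * axis_weight lam (Im w)) \<partial>lborel) \<le> ennreal N"
  shows "u z powr q * ((1 - norm z)\<^sup>2 * axis_weight lam (\<bar>Im z\<bar> + (1 - norm z)))
    \<le> 16 * mean_value_const lam * (4 / axis_weight lam (1/3)) powr ((1 - q) / q)
        / (axis_weight lam (1/2))\<^sup>2 * N"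
proof -
  define R where "R = (1 + norm z) / 2"
  have R: "0 < R" "R < 1" "norm z < R" using z norm_ge_zero[of z] by (auto simp: R_def simp del: norm_ge_zero)
  define W where "W w = (R - norm w)\<^sup>2 * axis_weight lam (\<bar>Im w\<bar> + (R - norm w))" for w
  define k where "k = axis_weight lam (1/3) / 4"
  define C where "C = mean_value_const lam"
  have C: "0 < C" using mean_value_const_pos[OF lam] by (simp add: C_def)
  have k: "0 < k" using axis_weight_pos[of "1/3" lam] by (simp add: k_def)
  have h: "0 < axis_weight lam (1/2)" by (rule axis_weight_pos) simp
  have sub: "cball 0 R \<subseteq> ball 0 1" using R by auto
  have "continuous_on (cball 0 R) (\<lambda>w. u w powr q * W w)"
    unfolding W_def
    using q nonneg sub
    by (intro continuous_intros continuous_on_powr' lam continuous_on_subset[OF continuous_on_u]) auto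
  then obtain z0 where z0: "z0 \<in> cball 0 R" and max: "\<And>w. w \<in> cball 0 R \<Longrightarrow> u w powr q * W w \<le> u z0 powr q * W z0"
    using continuous_attains_sup[of "cball 0 R" "\<lambda>w. u w powr q * W w"] R by auto
  define K where "K = 4 * C * (1 / k) powr ((1 - q) / q) / axis_weight lam (1/2)"
  have K: "0 < K" using C k h by (simp add: K_def)
  have "u z0 powr q * W z0 \<le> K * N"
  proof (cases "u z0 = 0 \<or> norm z0 = R")
    case True
    then have "u z0 powr q * W z0 = 0" by (auto simp: W_def)
    then show ?thesis using mult_pos_pos[OF K N] by linarith
  next
    case False
    then have u0: "0 < u z0" using nonneg[of z0] z0 sub by fastforce
    define d where "d = R - norm z0"
    have d: "0 < d" using False z0 by (auto simp: d_def)
    define r where "r = d / 2"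
    have r: "0 < r" "2 * r < 1 - norm z0" using d R by (auto simp: r_def d_def)
    define Y where "Y = \<bar>Im z0\<bar> + d"
    have Y: "0 < Y" using d by (simp add: Y_def)
    have W0: "W z0 = d\<^sup>2 * axis_weight lam Y" by (simp add: W_def d_def Y_def)
    have W0pos: "0 < W z0" unfolding W0 using d Y axis_weight_pos[of Y lam] by simp
    define L where "L = (u z0 * (1 / k) powr (1 / q)) powr (1 - q)"
    have L: "0 \<le> L" by (simp add: L_def)
    have near: "u w \<le> L * u w powr q" "w \<in> ball 0 1" if w: "w \<in> ball z0 r" for w
    proof -
      have nw: "norm (w - z0) < r" using w by (simp add: dist_norm norm_minus_commute)
      have n1: "norm w \<le> norm z0 + norm (w - z0)" using norm_triangle_ineq[of z0 "w - z0"] by simp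
      have n2: "\<bar>Im z0\<bar> \<le> \<bar>Im w\<bar> + norm (w - z0)" using abs_Im_le_cmod[of "w - z0"] by simp
      have dw: "d / 2 \<le> R - norm w" using n1 nw by (simp add: d_def r_def)
      have Yw: "Y / 3 \<le> \<bar>Im w\<bar> + (R - norm w)" using n1 n2 nw by (simp add: d_def r_def Y_def)
      have wR: "w \<in> cball 0 R" using dw d by auto
      then show "w \<in> ball 0 1" using sub by blast
      have uw: "0 \<le> u w" using wR sub nonneg by blast
      have "k * W z0 = (d / 2)\<^sup>2 * axis_weight lam (1/3 * Y)"
        unfolding axis_weight_mult by (simp add: k_def W0 power2_eq_square)
      also have "\<dots> \<le> W w"
        unfolding W_def
        using dw d Yw Y by (intro mult_mono power_mono axis_weight_mono lam axis_weight_nonneg) auto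
      finally have kW: "k * W z0 \<le> W w" .
      have "u w powr q * (k * W z0) \<le> u w powr q * W w" by (rule mult_left_mono[OF kW]) simp
      also have "\<dots> \<le> u z0 powr q * W z0" by (rule max[OF wR])
      finally have "u w powr q \<le> u z0 powr q * (1 / k)"
        using W0pos k by (simp add: field_simps)
      then have "(u w powr q) powr (1 / q) \<le> (u z0 powr q * (1 / k)) powr (1 / q)"
        using q by (intro powr_mono2) auto
      then have "u w \<le> u z0 * (1 / k) powr (1 / q)"
        using q uw u0 k by (simp add: powr_mult powr_powr powr_divide)
      then have "u w powr (1 - q) \<le> L"
        unfolding L_def using q uw by (intro powr_mono2) auto
      then have "u w powr (1 - q) * u w powr q \<le> L * u w powr q"
        by (rule mult_right_mono) simp
      then show "u w \<le> L * u w powr q"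
        using uw by (cases "u w = 0") (auto simp: powr_add[symmetric])
    qed
    have "mass z0 r \<le> (\<integral>\<^sup>+ w. ennreal L * (ennreal (u w powr q * axis_weight lam (Im w)) * indicator (ball 0 1) w) \<partial>lborel)"
      unfolding weighted_mass_def
    proof (intro nn_integral_mono)
      fix w
      show "ennreal (u w * axis_weight lam (Im w)) * indicator (ball z0 r) w
         \<le> ennreal L * (ennreal (u w powr q * axis_weight lam (Im w)) * indicator (ball 0 1) w)"
      proof (cases "w \<in> ball z0 r")
        case True
        have "u w * axis_weight lam (Im w) \<le> L * (u w powr q * axis_weight lam (Im w))"
          using mult_right_mono[OF near(1)[OF True] axis_weight_nonneg] by (simp add: mult.assoc)
        then show ?thesis
          using True near(2)[OF True] L by (simp add: ennreal_mult'[symmetric] ennreal_leI)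
      qed simp
    qed
    also have "\<dots> = ennreal L * (\<integral>\<^sup>+ w\<in>ball 0 1. ennreal (u w powr q * axis_weight lam (Im w)) \<partial>lborel)"
      using q nonneg
      by (intro nn_integral_cmult) (simp, intro measurable_ennreal_indicator continuous_intros continuous_on_powr' lam continuous_on_u, auto)
    also have "\<dots> \<le> ennreal L * ennreal N" by (rule mult_left_mono[OF int]) simp
    also have "\<dots> = ennreal (L * N)" using L by (simp add: ennreal_mult')
    finally have "mass z0 r \<le> ennreal (L * N)" .
    from mean_value_inequality[OF r _ this]
    have mv: "u z0 * (r\<^sup>2 * axis_weight lam (\<bar>Im z0\<bar> + r)) \<le> C * (L * N)"
      using L N by (simp add: C_def)
    have "axis_weight lam (1/2 * Y) \<le> axis_weight lam (\<bar>Im z0\<bar> + r)"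
      using d by (intro axis_weight_mono lam) (auto simp: Y_def r_def)
    then have "r\<^sup>2 * axis_weight lam (1/2 * Y) \<le> r\<^sup>2 * axis_weight lam (\<bar>Im z0\<bar> + r)"
      by (rule mult_left_mono) simp
    moreover have "axis_weight lam (1/2) / 4 * W z0 = r\<^sup>2 * axis_weight lam (1/2 * Y)"
      unfolding axis_weight_mult by (simp add: W0 r_def power2_eq_square)
    ultimately have "axis_weight lam (1/2) / 4 * W z0 \<le> r\<^sup>2 * axis_weight lam (\<bar>Im z0\<bar> + r)"
      by simp
    then have "u z0 * (axis_weight lam (1/2) / 4 * W z0) \<le> C * (L * N)"
      using mult_left_mono[of _ _ "u z0"] u0 mv by (meson less_imp_le order_trans)
    also have "C * (L * N) = u z0 powr (1 - q) * (C * (1 / k) powr ((1 - q) / q) * N)"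
      using u0 k by (simp add: L_def powr_mult powr_powr)
    finally have "u z0 * (axis_weight lam (1/2) / 4 * W z0) \<le> u z0 powr (1 - q) * (C * (1 / k) powr ((1 - q) / q) * N)" .
    moreover have "u z0 * (axis_weight lam (1/2) / 4 * W z0)
        = u z0 powr (1 - q) * (u z0 powr q * W z0 * (axis_weight lam (1/2) / 4))"
    proof -
      have "u z0 powr (1 - q) * u z0 powr q = u z0"
        using u0 by (simp add: powr_add[symmetric])
      then show ?thesis by (simp flip: mult.assoc)
    qed
    ultimately have "u z0 powr (1 - q) * (u z0 powr q * W z0 * (axis_weight lam (1/2) / 4))
       \<le> u z0 powr (1 - q) * (C * (1 / k) powr ((1 - q) / q) * N)"
      by (simp only:)
    then have "u z0 powr q * W z0 * (axis_weight lam (1/2) / 4) \<le> C * (1 / k) powr ((1 - q) / q) * N"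
      using u0 by simp
    then show ?thesis using h by (simp add: K_def field_simps)
  qed
  moreover have "u z powr q * W z \<le> u z0 powr q * W z0"
    using R by (intro max) auto
  ultimately have zW: "u z powr q * W z \<le> K * N" by linarith
  have Rz: "R - norm z = 1/2 * (1 - norm z)" by (simp add: R_def field_simps)
  have "axis_weight lam (1/2 * (\<bar>Im z\<bar> + (1 - norm z))) \<le> axis_weight lam (\<bar>Im z\<bar> + (R - norm z))"
  proof (intro axis_weight_mono lam)
    have "0 \<le> \<bar>Im z\<bar>" "0 < 1 - norm z" using z by auto
    moreover have "\<bar>1/2 * (a + t)\<bar> \<le> \<bar>a + 1/2 * t\<bar>" if "0 \<le> a" "0 < t" for a t :: real
      using that by (subst (1 2) abs_of_nonneg) (simp_all add: field_simps)
    ultimately show "\<bar>1/2 * (\<bar>Im z\<bar> + (1 - norm z))\<bar> \<le> \<bar>\<bar>Im z\<bar> + (R - norm z)\<bar>"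
      unfolding Rz by blast
  qed
  then have "(R - norm z)\<^sup>2 * axis_weight lam (1/2 * (\<bar>Im z\<bar> + (1 - norm z))) \<le> W z"
    unfolding W_def by (rule mult_left_mono) simp
  moreover have "axis_weight lam (1/2) / 4 * ((1 - norm z)\<^sup>2 * axis_weight lam (\<bar>Im z\<bar> + (1 - norm z)))
      = (R - norm z)\<^sup>2 * axis_weight lam (1/2 * (\<bar>Im z\<bar> + (1 - norm z)))"
    unfolding axis_weight_mult Rz power_mult_distrib by (simp add: power2_eq_square)
  ultimately have "axis_weight lam (1/2) / 4 * ((1 - norm z)\<^sup>2 * axis_weight lam (\<bar>Im z\<bar> + (1 - norm z))) \<le> W z"
    by simp
  then have "u z powr q * (axis_weight lam (1/2) / 4 * ((1 - norm z)\<^sup>2 * axis_weight lam (\<bar>Im z\<bar> + (1 - norm z)))) \<le> u z powr q * W z"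
    by (rule mult_left_mono) simp
  also note zW
  finally have "u z powr q * ((1 - norm z)\<^sup>2 * axis_weight lam (\<bar>Im z\<bar> + (1 - norm z))) \<le> 4 / axis_weight lam (1/2) * K * N"
    using h by (simp add: field_simps)
  also have "\<dots> = 16 * mean_value_const lam * (4 / axis_weight lam (1/3)) powr ((1 - q) / q)
        / (axis_weight lam (1/2))\<^sup>2 * N"
    by (simp add: K_def C_def k_def power2_eq_square)
  finally show ?thesis .
qed

end

lemma power_mean_value:
  assumes lam: "0 \<le> lam" and q: "0 < q"
  obtains C where "0 < C"
    "\<And>u ux uy uxx uyy z N. weighted_subsolution lam u ux uy uxx uyy \<Longrightarrow> z \<in> ball 0 1 \<Longrightarrow> 0 < N \<Longrightarrow>
       (\<integral>\<^sup>+ w\<in>ball 0 1. ennreal (u w powr q * axis_weight lam (Im w)) \<partial>lborel) \<le> ennreal N \<Longrightarrow>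
       u z powr q * ((1 - norm z)\<^sup>2 * axis_weight lam (\<bar>Im z\<bar> + (1 - norm z))) \<le> C * N"
proof (cases "1 \<le> q")
  case True
  show thesis
  proof (rule that)
    show "0 < (5 * mean_value_const lam) powr q * (16 * axis_weight lam 4)"
      using mean_value_const_pos[OF lam] axis_weight_pos[of 4 lam] by simp
  qed (rule weighted_subsolution.power_mean_value_ge_1[OF _ True])
next
  case False
  show thesis
  proof (rule that)
    show "0 < 16 * mean_value_const lam * (4 / axis_weight lam (1/3)) powr ((1 - q) / q) / (axis_weight lam (1/2))\<^sup>2"
      using mean_value_const_pos[OF lam] axis_weight_pos[of "1/3" lam] axis_weight_pos[of "1/2" lam] by simp
  qed (rule weighted_subsolution.power_mean_value_less_1[OF _ q], use False in auto)
qed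

section \<open>The second-order inequality for lambda-analytic functions\<close>

lemma has_vector_derivative_horizontal:
  assumes "(g has_derivative g') (at (Complex x y))"
  shows "((\<lambda>x. g (Complex x y)) has_vector_derivative g' 1) (at x)"
proof -
  have "((\<lambda>x. of_real x + Complex 0 y) has_derivative of_real) (at x)"
    by (auto intro!: derivative_eq_intros)
  moreover have "(\<lambda>x. of_real x + Complex 0 y) = (\<lambda>x. Complex x y)"
    by (auto simp: complex_eq_iff)
  ultimately have "((\<lambda>x. Complex x y) has_derivative of_real) (at x)" by simp
  from has_derivative_compose[OF this assms]
  have "((\<lambda>x. g (Complex x y)) has_derivative (\<lambda>h. g' (of_real h))) (at x)" .
  moreover have "g' (of_real h) = h *\<^sub>R g' 1" for h
    using linear_scale[OF has_derivative_linear[OF assms], of h 1] by (simp add: scaleR_conv_of_real)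
  ultimately show ?thesis by (simp add: has_vector_derivative_def)
qed

lemma has_vector_derivative_vertical:
  assumes "(g has_derivative g') (at (Complex x y))"
  shows "((\<lambda>y. g (Complex x y)) has_vector_derivative g' \<i>) (at y)"
proof -
  have "((\<lambda>y. \<i> * of_real y + Complex x 0) has_derivative (\<lambda>h. \<i> * of_real h)) (at y)"
    by (auto intro!: derivative_eq_intros)
  moreover have "(\<lambda>y. \<i> * of_real y + Complex x 0) = (\<lambda>y. Complex x y)"
    by (auto simp: complex_eq_iff)
  ultimately have "((\<lambda>y. Complex x y) has_derivative (\<lambda>h. \<i> * of_real h)) (at y)" by simp
  from has_derivative_compose[OF this assms]
  have "((\<lambda>y. g (Complex x y)) has_derivative (\<lambda>h. g' (\<i> * of_real h))) (at y)" .
  moreover have "g' (\<i> * of_real h) = h *\<^sub>R g' \<i>" for h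
    using linear_scale[OF has_derivative_linear[OF assms], of h \<i>] by (simp add: scaleR_conv_of_real mult.commute)
  ultimately show ?thesis by (simp add: has_vector_derivative_def)
qed

text \<open>
  By the fundamental theorem of calculus \<open>f (x, y) - f (x, b)\<close> is the integral of \<open>fy
  (x, t)\<close> over \<open>t\<close> from \<open>b\<close> to \<open>y\<close>. Differentiating under
  the integral in \<open>x\<close> expresses \<open>fx\<close> as an integral of \<open>fyx\<close>, and
  differentiating that in \<open>y\<close> gives \<open>fxy = fyx\<close>.
\<close>
lemma mixed_partials_commute:
  fixes f fx fy fxy fyx :: "complex \<Rightarrow> complex"
  assumes S: "open S" "z \<in> S"
    and fx: "\<And>x y. Complex x y \<in> S \<Longrightarrow> ((\<lambda>x. f (Complex x y)) has_vector_derivative fx (Complex x y)) (at x)"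
    and fy: "\<And>x y. Complex x y \<in> S \<Longrightarrow> ((\<lambda>y. f (Complex x y)) has_vector_derivative fy (Complex x y)) (at y)"
    and fxy: "\<And>x y. Complex x y \<in> S \<Longrightarrow> ((\<lambda>y. fx (Complex x y)) has_vector_derivative fxy (Complex x y)) (at y)"
    and fyx: "\<And>x y. Complex x y \<in> S \<Longrightarrow> ((\<lambda>x. fy (Complex x y)) has_vector_derivative fyx (Complex x y)) (at x)"
    and cont: "continuous_on S fyx" "continuous_on S fy"
  shows "fxy z = fyx z"
proof -
  define a b where "a = Re z" and "b = Im z"
  have z: "z = Complex a b" by (simp add: a_def b_def)
  obtain e0 where e0: "0 < e0" "ball z e0 \<subseteq> S" using S openE by blast
  define e where "e = e0 / 4"
  have e: "0 < e" using e0 by (simp add: e_def)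
  have box: "Complex x y \<in> S" if "x \<in> {a-e..a+e}" "y \<in> {b..b+e}" for x y
  proof -
    have "norm (Complex x y - z) \<le> \<bar>x - a\<bar> + \<bar>y - b\<bar>"
      using cmod_le[of "Complex x y - z"] by (simp add: z)
    also have "\<dots> < e0" using that e by (auto simp: e_def abs_le_iff)
    finally show ?thesis using e0(2) by (auto simp: dist_norm norm_minus_commute)
  qed
  have cont2: "continuous_on (U \<times> cbox b y) (\<lambda>(x, t). g (Complex x t))"
    if "continuous_on S g" "y \<in> {b..b+e}" "U \<subseteq> {a-e..a+e}" for g :: "complex \<Rightarrow> complex" and y U
    unfolding case_prod_unfold
  proof (rule continuous_on_compose2[OF that(1)])
    show "continuous_on (U \<times> cbox b y) (\<lambda>p. Complex (fst p) (snd p))"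
      by (intro continuous_intros)
    show "(\<lambda>p. Complex (fst p) (snd p)) ` (U \<times> cbox b y) \<subseteq> S"
    proof (intro image_subsetI)
      fix p assume "p \<in> U \<times> cbox b y"
      then have "fst p \<in> {a-e..a+e}" "snd p \<in> {b..b+e}" using that(2,3) by auto
      then show "Complex (fst p) (snd p) \<in> S" by (rule box)
    qed
  qed
  have fx_eq: "fx (Complex a y) = fx z + integral {b..y} (\<lambda>t. fyx (Complex a t))" if y: "y \<in> {b..b+e}" for y
  proof -
    have 1: "((\<lambda>x. integral (cbox b y) (\<lambda>t. fy (Complex x t))) has_vector_derivative
             integral (cbox b y) (\<lambda>t. fyx (Complex a t))) (at a within {a-e<..<a+e})"
    proof (rule leibniz_rule_vector_derivative[where fx = "\<lambda>x t. fyx (Complex x t)"])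
      show "((\<lambda>x. fy (Complex x t)) has_vector_derivative fyx (Complex x t)) (at x within {a-e<..<a+e})"
        if "x \<in> {a-e<..<a+e}" "t \<in> cbox b y" for x t
        by (rule has_vector_derivative_at_within, rule fyx, rule box) (use that y in auto)
      show "(\<lambda>t. fy (Complex x t)) integrable_on cbox b y" if "x \<in> {a-e<..<a+e}" for x
        by (rule integrable_continuous, rule continuous_on_fst_section[OF cont2[OF cont(2) y]])
           (use that in auto)
      show "continuous_on ({a-e<..<a+e} \<times> cbox b y) (\<lambda>(x, t). fyx (Complex x t))"
        by (rule cont2[OF cont(1) y]) auto
    qed (use e in auto)
    have "((\<lambda>t. fy (Complex x t)) has_integral (f (Complex x y) - f (Complex x b))) {b..y}"
      if x: "x \<in> {a-e<..<a+e}" for x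
    proof (rule fundamental_theorem_of_calculus)
      show "((\<lambda>t. f (Complex x t)) has_vector_derivative fy (Complex x t)) (at t within {b..y})"
        if "t \<in> {b..y}" for t
        by (rule has_vector_derivative_at_within, rule fy, rule box) (use that x y in auto)
    qed (use y in auto)
    then have eq: "integral (cbox b y) (\<lambda>t. fy (Complex x t)) = f (Complex x y) - f (Complex x b)"
      if "x \<in> {a-e<..<a+e}" for x
      using that by (simp add: integral_unique)
    have 2: "((\<lambda>x. f (Complex x y) - f (Complex x b)) has_vector_derivative fx (Complex a y) - fx (Complex a b)) (at a)"
      by (intro has_vector_derivative_diff fx box) (use y e in auto)
    have 3: "((\<lambda>x. f (Complex x y) - f (Complex x b)) has_vector_derivative
             integral (cbox b y) (\<lambda>t. fyx (Complex a t))) (at a)"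
      using 1 e at_within_open[of a "{a-e<..<a+e}"]
      by (intro has_vector_derivative_transform_within_open[where S = "{a-e<..<a+e}", OF _ _ _ eq]) auto
    show ?thesis
      using vector_derivative_unique_at[OF 2 3] z by (metis add.commute box_real(2) diff_add_cancel)
  qed
  have "((\<lambda>y. fx z + integral {b..y} (\<lambda>t. fyx (Complex a t))) has_vector_derivative 0 + fyx (Complex a b)) (at b within {b..b+e})"
  proof (intro has_vector_derivative_add has_vector_derivative_const integral_has_vector_derivative)
    have "continuous_on {b..b + e} (\<lambda>t. fyx (Complex a t))"
      using continuous_on_fst_section[OF cont2[OF cont(1), of "b+e" "{a-e..a+e}"], of a] e by simp
    then show "continuous_on {b..b + e} (\<lambda>t. fyx (Complex a t))" .
  qed (use e in auto)
  then have "((\<lambda>y. fx z + integral {b..y} (\<lambda>t. fyx (Complex a t))) has_vector_derivative fyx z) (at b within {b..b+e})"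
    by (simp add: z)
  then have "((\<lambda>y. fx (Complex a y)) has_vector_derivative fyx z) (at b within {b..b+e})"
    by (rule has_vector_derivative_transform[rotated 2]) (use fx_eq e in auto)
  moreover have "((\<lambda>y. fx (Complex a y)) has_vector_derivative fxy z) (at b within {b..b+e})"
    using fxy[of a b] S(2) by (simp add: z has_vector_derivative_at_within)
  ultimately show ?thesis
    by (intro vector_derivative_unique_within[of b "{b..b+e}"]) (use e in \<open>simp_all add: at_within_Icc_at_right\<close>)
qed

lemma C2_on_partials:
  assumes "C2_on S f" "open S"
  obtains fx fy fxx fxy fyy where
    "\<And>z. z \<in> S \<Longrightarrow> (f has_derivative (\<lambda>h. Re h *\<^sub>R fx z + Im h *\<^sub>R fy z)) (at z)"
    "\<And>x y. Complex x y \<in> S \<Longrightarrow> ((\<lambda>x. f (Complex x y)) has_vector_derivative fx (Complex x y)) (at x)"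
    "\<And>x y. Complex x y \<in> S \<Longrightarrow> ((\<lambda>y. f (Complex x y)) has_vector_derivative fy (Complex x y)) (at y)"
    "\<And>x y. Complex x y \<in> S \<Longrightarrow> ((\<lambda>x. fx (Complex x y)) has_vector_derivative fxx (Complex x y)) (at x)"
    "\<And>x y. Complex x y \<in> S \<Longrightarrow> ((\<lambda>y. fx (Complex x y)) has_vector_derivative fxy (Complex x y)) (at y)"
    "\<And>x y. Complex x y \<in> S \<Longrightarrow> ((\<lambda>x. fy (Complex x y)) has_vector_derivative fxy (Complex x y)) (at x)"
    "\<And>x y. Complex x y \<in> S \<Longrightarrow> ((\<lambda>y. fy (Complex x y)) has_vector_derivative fyy (Complex x y)) (at y)"
    "continuous_on S f" "continuous_on S fx" "continuous_on S fy" "continuous_on S fyy"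
proof -
  obtain f' :: "complex \<Rightarrow> complex \<Rightarrow>\<^sub>L complex" and f'' :: "complex \<Rightarrow> complex \<Rightarrow>\<^sub>L complex \<Rightarrow>\<^sub>L complex"
    where f': "\<And>z. z \<in> S \<Longrightarrow> (f has_derivative blinfun_apply (f' z)) (at z)"
      and f'': "\<And>z. z \<in> S \<Longrightarrow> (f' has_derivative blinfun_apply (f'' z)) (at z)"
      and cont: "continuous_on S f''"
    using assms(1) unfolding C2_on_def by blast
  have d2: "((\<lambda>z. blinfun_apply (f' z) k) has_derivative (\<lambda>h. blinfun_apply (blinfun_apply (f'' z) h) k)) (at z)"
    if "z \<in> S" for z k
    by (rule bounded_linear.has_derivative[OF blinfun.bounded_linear_left f''[OF that]])
  have c2: "continuous_on S (\<lambda>z. blinfun_apply (blinfun_apply (f'' z) h) k)" for h k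
    by (intro continuous_intros cont)
  have c1: "continuous_on S (\<lambda>z. blinfun_apply (f' z) k)" for k
    by (intro continuous_at_imp_continuous_on ballI has_derivative_continuous[OF d2])
  have c0: "continuous_on S f"
    by (intro continuous_at_imp_continuous_on ballI has_derivative_continuous[OF f'])
  have sym: "blinfun_apply (blinfun_apply (f'' z) \<i>) 1 = blinfun_apply (blinfun_apply (f'' z) 1) \<i>" if "z \<in> S" for z
  proof (rule mixed_partials_commute[OF assms(2) that, where f = f
        and fx = "\<lambda>z. blinfun_apply (f' z) 1" and fxy = "\<lambda>z. blinfun_apply (blinfun_apply (f'' z) \<i>) 1"
        and fy = "\<lambda>z. blinfun_apply (f' z) \<i>" and fyx = "\<lambda>z. blinfun_apply (blinfun_apply (f'' z) 1) \<i>"])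
    fix x y assume S: "Complex x y \<in> S"
    show "((\<lambda>x. f (Complex x y)) has_vector_derivative blinfun_apply (f' (Complex x y)) 1) (at x)"
      by (rule has_vector_derivative_horizontal[OF f'[OF S]])
    show "((\<lambda>y. f (Complex x y)) has_vector_derivative blinfun_apply (f' (Complex x y)) \<i>) (at y)"
      by (rule has_vector_derivative_vertical[OF f'[OF S]])
    show "((\<lambda>y. blinfun_apply (f' (Complex x y)) 1) has_vector_derivative
        blinfun_apply (blinfun_apply (f'' (Complex x y)) \<i>) 1) (at y)"
      by (rule has_vector_derivative_vertical[OF d2[OF S]])
    show "((\<lambda>x. blinfun_apply (f' (Complex x y)) \<i>) has_vector_derivative
        blinfun_apply (blinfun_apply (f'' (Complex x y)) 1) \<i>) (at x)"
      by (rule has_vector_derivative_horizontal[OF d2[OF S]])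
  qed (rule c1 c2)+
  show thesis
  proof (rule that)
    show "(f has_derivative (\<lambda>h. Re h *\<^sub>R blinfun_apply (f' z) 1 + Im h *\<^sub>R blinfun_apply (f' z) \<i>)) (at z)" if "z \<in> S" for z
    proof (rule has_derivative_eq_rhs[OF f'[OF that]], rule ext)
      fix h :: complex
      have "h = Re h *\<^sub>R 1 + Im h *\<^sub>R \<i>" by (simp add: complex_eq_iff)
      then show "blinfun_apply (f' z) h = Re h *\<^sub>R blinfun_apply (f' z) 1 + Im h *\<^sub>R blinfun_apply (f' z) \<i>"
        by (metis blinfun.add_right blinfun.scaleR_right)
    qed
    show "((\<lambda>x. blinfun_apply (f' (Complex x y)) \<i>) has_vector_derivative
        blinfun_apply (blinfun_apply (f'' (Complex x y)) \<i>) 1) (at x)" if "Complex x y \<in> S" for x y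
      using has_vector_derivative_horizontal[OF d2[OF that, of \<i>]] sym[OF that] by simp
    show "((\<lambda>x. f (Complex x y)) has_vector_derivative blinfun_apply (f' (Complex x y)) 1) (at x)" if "Complex x y \<in> S" for x y
      by (rule has_vector_derivative_horizontal[OF f'[OF that]])
    show "((\<lambda>y. f (Complex x y)) has_vector_derivative blinfun_apply (f' (Complex x y)) \<i>) (at y)" if "Complex x y \<in> S" for x y
      by (rule has_vector_derivative_vertical[OF f'[OF that]])
    show "((\<lambda>x. blinfun_apply (f' (Complex x y)) 1) has_vector_derivative
        blinfun_apply (blinfun_apply (f'' (Complex x y)) 1) 1) (at x)" if "Complex x y \<in> S" for x y
      by (rule has_vector_derivative_horizontal[OF d2[OF that]])
    show "((\<lambda>y. blinfun_apply (f' (Complex x y)) 1) has_vector_derivative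
        blinfun_apply (blinfun_apply (f'' (Complex x y)) \<i>) 1) (at y)" if "Complex x y \<in> S" for x y
      by (rule has_vector_derivative_vertical[OF d2[OF that]])
    show "((\<lambda>y. blinfun_apply (f' (Complex x y)) \<i>) has_vector_derivative
        blinfun_apply (blinfun_apply (f'' (Complex x y)) \<i>) \<i>) (at y)" if "Complex x y \<in> S" for x y
      by (rule has_vector_derivative_vertical[OF d2[OF that]])
  qed (rule c0 c1 c2)+
qed

definition symmetric_square :: "(complex \<Rightarrow> complex) \<Rightarrow> complex \<Rightarrow> real" where
  "symmetric_square f z = (norm (f z))\<^sup>2 + (norm (f (cnj z)))\<^sup>2"

text \<open>
  Applying \<open>\<partial>_x - \<i> * \<partial>_y\<close> to the first-order equation and eliminating
  \<open>fx\<close> by means of that equation, both at \<open>z\<close> and at \<open>cnj z\<close>,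
  gives the identity \<open>laplace\<close>: the weighted Laplacian of \<open>f\<close> is \<open>(lam /
  y\<^sup>2) * (f z - f (cnj z))\<close>. Taking inner products with \<open>f z\<close> and, at the
  reflected point, with \<open>f (cnj z)\<close>, the two right-hand sides combine to a square.
\<close>
lemma symmetric_square_subsolution:
  assumes lam: "0 \<le> lam" and f: "lambda_analytic lam f"
  obtains ux uy uxx uyy where "weighted_subsolution lam (symmetric_square f) ux uy uxx uyy"
proof -
  let ?D = "ball (0::complex) 1"
  have C2: "C2_on ?D f" and eq0: "\<And>z. z \<in> ?D \<Longrightarrow> D_zbar lam f z = 0"
    using f by (auto simp: lambda_analytic_def)
  obtain fx fy fxx fxy fyy where
    df: "\<And>z. z \<in> ?D \<Longrightarrow> (f has_derivative (\<lambda>h. Re h *\<^sub>R fx z + Im h *\<^sub>R fy z)) (at z)"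
    and dx: "\<And>x y. Complex x y \<in> ?D \<Longrightarrow> ((\<lambda>x. f (Complex x y)) has_vector_derivative fx (Complex x y)) (at x)"
    and dy: "\<And>x y. Complex x y \<in> ?D \<Longrightarrow> ((\<lambda>y. f (Complex x y)) has_vector_derivative fy (Complex x y)) (at y)"
    and dxx: "\<And>x y. Complex x y \<in> ?D \<Longrightarrow> ((\<lambda>x. fx (Complex x y)) has_vector_derivative fxx (Complex x y)) (at x)"
    and dxy: "\<And>x y. Complex x y \<in> ?D \<Longrightarrow> ((\<lambda>y. fx (Complex x y)) has_vector_derivative fxy (Complex x y)) (at y)"
    and dyx: "\<And>x y. Complex x y \<in> ?D \<Longrightarrow> ((\<lambda>x. fy (Complex x y)) has_vector_derivative fxy (Complex x y)) (at x)"
    and dyy: "\<And>x y. Complex x y \<in> ?D \<Longrightarrow> ((\<lambda>y. fy (Complex x y)) has_vector_derivative fyy (Complex x y)) (at y)"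
    and cont: "continuous_on ?D f" "continuous_on ?D fx" "continuous_on ?D fy" "continuous_on ?D fyy"
    using C2_on_partials[OF C2 open_ball] by blast
  have cnjD: "cnj z \<in> ?D" if "z \<in> ?D" for z using that by simp
  have cnjC: "Complex x (-y) \<in> ?D" if "Complex x y \<in> ?D" for x y
    using cnjD[OF that] by (simp add: complex_cnj)
  \<comment> \<open>The equation takes the form \<open>fx + \<i> * fy = c * (f z - f (cnj z)) / y\<close>.\<close>
  define c where "c = - \<i> * of_real lam"
  have system: "fx (Complex x y) + \<i> * fy (Complex x y) = c * ((f (Complex x y) - f (Complex x (-y))) / of_real y)"
    if D: "Complex x y \<in> ?D" and y: "y \<noteq> 0" for x y
  proof -
    have 1: "((\<lambda>t. Complex x y + of_real t) has_derivative of_real) (at 0)"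
      by (auto intro!: derivative_eq_intros)
    have "((\<lambda>t. f (Complex x y + of_real t)) has_vector_derivative fx (Complex x y)) (at 0)"
      using has_derivative_compose[OF 1, of f, OF df[of "Complex x y + of_real 0"]] D
      by (simp add: has_vector_derivative_def)
    then have px: "partial_x f (Complex x y) = fx (Complex x y)"
      unfolding partial_x_def by (rule vector_derivative_at)
    have 2: "((\<lambda>t. Complex x y + \<i> * of_real t) has_derivative (\<lambda>h. \<i> * of_real h)) (at 0)"
      by (auto intro!: derivative_eq_intros)
    have "((\<lambda>t. f (Complex x y + \<i> * of_real t)) has_vector_derivative fy (Complex x y)) (at 0)"
      using has_derivative_compose[OF 2, of f, OF df[of "Complex x y + \<i> * of_real 0"]] D
      by (simp add: has_vector_derivative_def)
    then have py: "partial_y f (Complex x y) = fy (Complex x y)"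
      unfolding partial_y_def by (rule vector_derivative_at)
    have "Complex x y - cnj (Complex x y) = 2 * \<i> * of_real y" by (simp add: complex_eq_iff)
    then have "(fx (Complex x y) + \<i> * fy (Complex x y)) / 2
       = of_real lam * ((f (Complex x y) - f (Complex x (-y))) / (2 * \<i> * of_real y))"
      using eq0[OF D] y by (simp add: D_zbar_def partial_zbar_def reflection_quotient_def px py complex_cnj)
    moreover have "d / (2 * \<i> * of_real y) = - (\<i> / 2) * (d / of_real y)" for d :: complex
      using y by (simp add: nonzero_divide_eq_eq mult_ac)
    ultimately show ?thesis
      by (simp add: c_def)
  qed
  have laplace: "fxx (Complex x y) + fyy (Complex x y) + (2 * lam / y) *\<^sub>R fy (Complex x y)
      = (lam / y\<^sup>2) *\<^sub>R (f (Complex x y) - f (Complex x (-y)))"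
    if D: "Complex x y \<in> ?D" and y: "y \<noteq> 0" for x y
  proof -
    define w w' where "w = Complex x y" and "w' = Complex x (-y)"
    have D': "Complex x (-y) \<in> ?D" by (rule cnjC[OF D])
    have X: "fxx w + \<i> * fxy w = c * ((fx w - fx w') / of_real y)"
    proof -
      have 1: "((\<lambda>x. fx (Complex x y) + \<i> * fy (Complex x y)) has_vector_derivative fxx w + \<i> * fxy w) (at x)"
        unfolding w_def by (intro has_vector_derivative_add has_vector_derivative_mult_right dxx dyx D)
      have 2: "((\<lambda>x. c * ((f (Complex x y) - f (Complex x (-y))) / of_real y)) has_vector_derivative
           c * ((fx w - fx w') / of_real y)) (at x)"
        unfolding w_def w'_def
        by (intro has_vector_derivative_mult_right has_vector_derivative_divide has_vector_derivative_diff dx D D')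
      have "open ((\<lambda>x. Complex x y) -` ?D)"
        by (intro open_vimage continuous_intros open_ball)
      from has_vector_derivative_transform_within_open[OF 1 this, of "\<lambda>x. c * ((f (Complex x y) - f (Complex x (-y))) / of_real y)"]
      have "((\<lambda>x. c * ((f (Complex x y) - f (Complex x (-y))) / of_real y)) has_vector_derivative fxx w + \<i> * fxy w) (at x)"
        using D system y by auto
      from vector_derivative_unique_at[OF this 2] show ?thesis .
    qed
    have Y: "fxy w + \<i> * fyy w = c * ((fy w + fy w') / of_real y - (f w - f w') / (of_real y)\<^sup>2)"
    proof -
      have 1: "((\<lambda>y. fx (Complex x y) + \<i> * fy (Complex x y)) has_vector_derivative fxy w + \<i> * fyy w) (at y)"
        unfolding w_def by (intro has_vector_derivative_add has_vector_derivative_mult_right dxy dyy D)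
      have n: "((\<lambda>y. f (Complex x (-y))) has_vector_derivative - fy w') (at y)"
      proof -
        have "((\<lambda>y::real. - y) has_vector_derivative -1) (at y)"
          by (auto intro!: derivative_eq_intros)
        from vector_diff_chain_at[OF this dy[OF D']] show ?thesis by (simp add: o_def w'_def)
      qed
      have inv: "((\<lambda>y. inverse (of_real y) :: complex) has_vector_derivative - 1 / (of_real y)\<^sup>2) (at y)"
      proof -
        have "((\<lambda>y. inverse y :: complex) has_field_derivative - (inverse (of_real y) ^ Suc (Suc 0))) (at (of_real y))"
          using DERIV_inverse[of "of_real y :: complex"] y by simp
        from field_vector_diff_chain_at[where f = of_real and f' = 1 and x = y, OF _ this]
        show ?thesis by (simp add: o_def power2_eq_square divide_inverse has_vector_derivative_of_real[OF DERIV_ident, simplified])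
      qed
      have "((\<lambda>y. f (Complex x y) - f (Complex x (-y))) has_vector_derivative fy w - (- fy w')) (at y)"
        by (intro has_vector_derivative_diff n) (use dy[OF D] in \<open>simp add: w_def\<close>)
      from has_vector_derivative_mult_right[OF has_vector_derivative_mult[OF this inv], of c]
      have 2: "((\<lambda>y. c * ((f (Complex x y) - f (Complex x (-y))) / of_real y)) has_vector_derivative
           c * ((fy w + fy w') / of_real y - (f w - f w') / (of_real y)\<^sup>2)) (at y)"
        by (simp add: w_def w'_def divide_inverse algebra_simps)
      have op: "open (((\<lambda>y. Complex x y) -` ?D) - {0})"
        by (intro open_Diff open_vimage continuous_intros open_ball closed_singleton)
      from has_vector_derivative_transform_within_open[OF 1 this, of "\<lambda>y. c * ((f (Complex x y) - f (Complex x (-y))) / of_real y)"]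
      have "((\<lambda>y. c * ((f (Complex x y) - f (Complex x (-y))) / of_real y)) has_vector_derivative fxy w + \<i> * fyy w) (at y)"
        using D system y by auto
      from vector_derivative_unique_at[OF this 2] show ?thesis .
    qed
    have E: "fx w = c * ((f w - f w') / of_real y) - \<i> * fy w"
      using system[OF D y] by (simp add: w_def w'_def algebra_simps)
    have E': "fx w' = c * ((f w - f w') / of_real y) - \<i> * fy w'"
      using system[OF D'] y by (simp add: w_def w'_def algebra_simps diff_divide_distrib)
    \<comment> \<open>The mixed partial derivatives in \<open>X\<close> and \<open>Y\<close> cancel.\<close>
    have "fxx w + fyy w = (fxx w + \<i> * fxy w) - \<i> * (fxy w + \<i> * fyy w)"
      by (simp add: algebra_simps)
    also have "\<dots> = - (2 * of_real lam * fy w / of_real y) + of_real lam * (f w - f w') / (of_real y)\<^sup>2"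
      unfolding X Y E E' using y by (simp add: c_def field_simps power2_eq_square)
    finally show ?thesis
      using y by (simp add: w_def w'_def scaleR_conv_of_real field_simps)
  qed
  let ?ux = "\<lambda>z. 2 * (f z \<bullet> fx z) + 2 * (f (cnj z) \<bullet> fx (cnj z))"
  let ?uy = "\<lambda>z. 2 * (f z \<bullet> fy z) - 2 * (f (cnj z) \<bullet> fy (cnj z))"
  let ?uxx = "\<lambda>z. 2 * (fx z \<bullet> fx z + f z \<bullet> fxx z) + 2 * (fx (cnj z) \<bullet> fx (cnj z) + f (cnj z) \<bullet> fxx (cnj z))"
  let ?uyy = "\<lambda>z. 2 * (fy z \<bullet> fy z + f z \<bullet> fyy z) + 2 * (fy (cnj z) \<bullet> fy (cnj z) + f (cnj z) \<bullet> fyy (cnj z))"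
  have ccnj: "continuous_on ?D (\<lambda>z. g (cnj z))" if "continuous_on ?D g" for g :: "complex \<Rightarrow> complex"
    by (rule continuous_on_compose2[OF that]) (auto intro!: continuous_intros)
  have inner_deriv: "((\<lambda>t. g t \<bullet> h t) has_real_derivative g t \<bullet> h' + g' \<bullet> h t) (at t)"
    if "(g has_vector_derivative g') (at t)" "(h has_vector_derivative h') (at t)"
    for g h :: "real \<Rightarrow> complex" and g' h' t
    using has_derivative_inner[OF that[unfolded has_vector_derivative_def]]
    unfolding has_field_derivative_def
    by (rule has_derivative_eq_rhs) (auto simp: algebra_simps)
  have flip: "((\<lambda>y. g (Complex x (-y))) has_vector_derivative - g') (at y)"
    if "((\<lambda>y. g (Complex x y)) has_vector_derivative g') (at (-y))" for g :: "complex \<Rightarrow> complex" and g' x y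
  proof -
    have "((\<lambda>y::real. - y) has_vector_derivative -1) (at y)"
      by (auto intro!: derivative_eq_intros)
    from vector_diff_chain_at[OF this that] show ?thesis by (simp add: o_def)
  qed
  have "weighted_subsolution lam (symmetric_square f) ?ux ?uy ?uxx ?uyy"
  proof
    show "0 \<le> lam" by (rule lam)
    show "0 \<le> symmetric_square f z" for z by (simp add: symmetric_square_def)
    show "(symmetric_square f has_derivative (\<lambda>h. Re h * ?ux z + Im h * ?uy z)) (at z)" if "z \<in> ?D" for z
    proof -
      have 1: "(cnj has_derivative cnj) (at z)"
        by (rule bounded_linear.has_derivative[OF bounded_linear_cnj has_derivative_ident])
      have 2: "((\<lambda>z. f (cnj z)) has_derivative (\<lambda>h. Re h *\<^sub>R fx (cnj z) + - Im h *\<^sub>R fy (cnj z))) (at z)"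
        using has_derivative_compose[OF 1 df[OF cnjD[OF that]]] by simp
      have "((\<lambda>z. f z \<bullet> f z + f (cnj z) \<bullet> f (cnj z)) has_derivative (\<lambda>h. Re h * ?ux z + Im h * ?uy z)) (at z)"
        by (rule has_derivative_eq_rhs[OF has_derivative_add[OF has_derivative_inner[OF df[OF that] df[OF that]] has_derivative_inner[OF 2 2]]])
           (auto simp: algebra_simps inner_commute)
      then show ?thesis
        by (simp add: symmetric_square_def[abs_def] power2_norm_eq_inner)
    qed
    show "continuous_on ?D ?ux" "continuous_on ?D ?uy" "continuous_on ?D ?uyy"
      by (intro continuous_intros cont ccnj)+
    fix x y assume D: "Complex x y \<in> ?D"
    note D' = cnjC[OF D]
    show "((\<lambda>x. ?ux (Complex x y)) has_real_derivative ?uxx (Complex x y)) (at x)"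
      using DERIV_add[OF DERIV_cmult[OF inner_deriv[OF dx[OF D] dxx[OF D]], of 2]
          DERIV_cmult[OF inner_deriv[OF dx[OF D'] dxx[OF D']], of 2]]
      by (simp add: complex_cnj algebra_simps)
    show "((\<lambda>y. ?uy (Complex x y)) has_real_derivative ?uyy (Complex x y)) (at y)"
      using DERIV_diff[OF DERIV_cmult[OF inner_deriv[OF dy[OF D] dyy[OF D]], of 2]
          DERIV_cmult[OF inner_deriv[OF flip[OF dy[OF D']] flip[OF dyy[OF D']]], of 2]]
      by (simp add: complex_cnj algebra_simps)
  next
    fix z assume D: "z \<in> ?D" and y: "Im z \<noteq> 0"
    have L1: "fxx z + fyy z + (2 * lam / Im z) *\<^sub>R fy z = (lam / (Im z)\<^sup>2) *\<^sub>R (f z - f (cnj z))"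
      using laplace[of "Re z" "Im z"] D y by (simp add: cnj.code)
    have L2: "fxx (cnj z) + fyy (cnj z) + (- (2 * lam / Im z)) *\<^sub>R fy (cnj z) = (lam / (Im z)\<^sup>2) *\<^sub>R (f (cnj z) - f z)"
      using laplace[of "Re z" "- Im z"] cnjD[OF D] y by (simp add: cnj.code)
    have "?uxx z + ?uyy z + 2 * lam / Im z * ?uy z
      = 2 * (fx z \<bullet> fx z + fy z \<bullet> fy z + fx (cnj z) \<bullet> fx (cnj z) + fy (cnj z) \<bullet> fy (cnj z))
        + 2 * (f z \<bullet> (fxx z + fyy z + (2 * lam / Im z) *\<^sub>R fy z))
        + 2 * (f (cnj z) \<bullet> (fxx (cnj z) + fyy (cnj z) + (- (2 * lam / Im z)) *\<^sub>R fy (cnj z)))"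
      by (simp add: inner_add_right algebra_simps)
    also have "\<dots> = 2 * (fx z \<bullet> fx z + fy z \<bullet> fy z + fx (cnj z) \<bullet> fx (cnj z) + fy (cnj z) \<bullet> fy (cnj z))
        + 2 * (lam / (Im z)\<^sup>2 * ((f z - f (cnj z)) \<bullet> (f z - f (cnj z))))"
      unfolding L1 L2 by (simp add: algebra_simps inner_commute)
    also have "\<dots> \<ge> 0" using lam by simp
    finally show "0 \<le> ?uxx z + ?uyy z + 2 * lam / Im z * ?uy z" .
  qed
  then show thesis by (rule that)
qed

section \<open>The Bergman integral\<close>

lemma lborel_distr_cnj: "distr lborel borel cnj = lborel"
proof (rule lborel_eqI[symmetric])
  have m: "cnj \<in> borel_measurable borel"
    by (intro borel_measurable_continuous_onI continuous_intros)
  fix l u :: complex assume le: "\<And>b. b \<in> Basis \<Longrightarrow> l \<bullet> b \<le> u \<bullet> b"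
  have "cnj -` box l u = box (Complex (Re l) (- Im u)) (Complex (Re u) (- Im l))"
    by (auto simp: box_def Basis_complex_def)
  moreover have "Re l \<le> Re u" "Im l \<le> Im u"
    using le[of 1] le[of \<i>] by (auto simp: Basis_complex_def)
  ultimately show "emeasure (distr lborel borel cnj) (box l u) = (\<Prod>b\<in>Basis. (u - l) \<bullet> b)"
    using m by (simp add: emeasure_distr emeasure_lborel_box_eq Basis_complex_def)
qed simp

lemma nn_integral_cnj:
  assumes "F \<in> borel_measurable borel"
  shows "(\<integral>\<^sup>+ z. F (cnj z) \<partial>lborel) = (\<integral>\<^sup>+ z. F z \<partial>lborel)"
proof -
  have m: "cnj \<in> borel_measurable borel"
    by (intro borel_measurable_continuous_onI continuous_intros)
  have "(\<integral>\<^sup>+ z. F z \<partial>lborel) = (\<integral>\<^sup>+ z. F z \<partial>distr lborel borel cnj)"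
    by (simp add: lborel_distr_cnj)
  also have "\<dots> = (\<integral>\<^sup>+ z. F (cnj z) \<partial>lborel)"
    using assms m by (simp add: nn_integral_distr)
  finally show ?thesis by simp
qed

lemma AE_off_real_axis: "AE z in lborel. Im z \<noteq> (0 :: real)"
proof -
  have "negligible {z :: complex. \<i> \<bullet> z = 0}"
    by (rule negligible_hyperplane) simp
  moreover have "{z :: complex. \<i> \<bullet> z = 0} = {z. Im z = 0}" by (simp add: inner_complex_def)
  ultimately have "{z :: complex. Im z = 0} \<in> null_sets lebesgue"
    by (simp add: negligible_iff_null_sets)
  moreover have "closed {z :: complex. Im z = 0}"
    by (intro closed_Collect_eq continuous_intros)
  ultimately have "{z :: complex. Im z = 0} \<in> null_sets lborel"
    by (simp add: null_sets_completion_iff)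
  from AE_not_in[OF this] show ?thesis by simp
qed

lemma c_lambda_pos: "0 \<le> lam \<Longrightarrow> 0 < c_lambda lam"
  unfolding c_lambda_def by (intro divide_pos_pos mult_pos_pos Gamma_real_pos) auto

lemma lambda_analytic_continuous:
  assumes "lambda_analytic lam f" shows "continuous_on (ball 0 1) f"
proof -
  obtain f' :: "complex \<Rightarrow> complex \<Rightarrow>\<^sub>L complex" where "\<forall>z\<in>ball 0 1. (f has_derivative blinfun_apply (f' z)) (at z)"
    using assms unfolding lambda_analytic_def C2_on_def by blast
  then show ?thesis
    by (intro continuous_at_imp_continuous_on ballI has_derivative_continuous) auto
qed

text \<open>
  Passing from \<open>\<bar>y\<bar> powr (2 * lam)\<close> to its continuous version
  \<open>axis_weight\<close> changes the density on the real axis only.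
\<close>
lemma bergman_integral_eq:
  assumes lam: "0 \<le> lam" and p: "0 < p" and f: "lambda_analytic lam f"
  shows "bergman_integral lam p f = ennreal (c_lambda lam) *
    (\<integral>\<^sup>+ w\<in>ball 0 1. ennreal (norm (f w) powr p * axis_weight lam (Im w)) \<partial>lborel)"
proof -
  note cf = lambda_analytic_continuous[OF f]
  have m1: "(\<lambda>z. ennreal (norm (f z) powr p) * indicator (ball 0 1) z) \<in> borel_measurable borel"
    using p by (intro measurable_ennreal_indicator continuous_on_powr' continuous_intros cf) auto
  have m2: "(\<lambda>z. ennreal (norm (f z) powr p * axis_weight lam (Im z)) * indicator (ball 0 1) z) \<in> borel_measurable borel"
    using p by (intro measurable_ennreal_indicator continuous_on_powr' continuous_intros cf lam) auto
  have m3: "(\<lambda>z. ennreal (c_lambda lam * \<bar>Im z\<bar> powr (2 * lam))) \<in> borel_measurable borel"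
    by measurable
  have "bergman_integral lam p f = (\<integral>\<^sup>+ z. ennreal (c_lambda lam * \<bar>Im z\<bar> powr (2 * lam)) *
       (ennreal (norm (f z) powr p) * indicator (ball 0 1) z) \<partial>lborel)"
    unfolding bergman_integral_def sigma_lambda_def
    using m1 m3 by (subst nn_integral_density) auto
  also have "\<dots> = (\<integral>\<^sup>+ z. ennreal (c_lambda lam) *
      (ennreal (norm (f z) powr p * axis_weight lam (Im z)) * indicator (ball 0 1) z) \<partial>lborel)"
  proof (rule nn_integral_cong_AE)
    show "AE z in lborel. ennreal (c_lambda lam * \<bar>Im z\<bar> powr (2 * lam)) * (ennreal (norm (f z) powr p) * indicator (ball 0 1) z)
       = ennreal (c_lambda lam) * (ennreal (norm (f z) powr p * axis_weight lam (Im z)) * indicator (ball 0 1) z)"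
      using AE_off_real_axis
    proof eventually_elim
      case (elim z)
      then show ?case
        using c_lambda_pos[OF lam]
        by (simp add: axis_weight_eq ennreal_mult' mult_ac)
    qed
  qed
  also have "\<dots> = ennreal (c_lambda lam) *
    (\<integral>\<^sup>+ w\<in>ball 0 1. ennreal (norm (f w) powr p * axis_weight lam (Im w)) \<partial>lborel)"
    using m2 by (intro nn_integral_cmult) simp
  finally show ?thesis .
qed

text \<open>
  Reflection in the real axis preserves both Lebesgue measure and the weight, so the term \<open>\<bar>f
  (cnj z)\<bar>\<close> contributes the same integral as \<open>\<bar>f z\<bar>\<close>.
\<close>
lemma symmetric_square_integral_le:
  assumes lam: "0 \<le> lam" and p: "0 < p" and f: "lambda_analytic lam f"
  defines "I \<equiv> (\<integral>\<^sup>+ w\<in>ball 0 1. ennreal (norm (f w) powr p * axis_weight lam (Im w)) \<partial>lborel)"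
  shows "(\<integral>\<^sup>+ w\<in>ball 0 1. ennreal (symmetric_square f w powr (p / 2) * axis_weight lam (Im w)) \<partial>lborel)
    \<le> ennreal (2 powr (p / 2)) * (I + I)"
proof -
  note cf = lambda_analytic_continuous[OF f]
  let ?F = "\<lambda>w. ennreal (norm (f w) powr p * axis_weight lam (Im w)) * indicator (ball 0 1) w"
  have mF: "?F \<in> borel_measurable borel"
    using p by (intro measurable_ennreal_indicator continuous_on_powr' continuous_intros cf lam) auto
  have mF': "(\<lambda>w. ?F (cnj w)) \<in> borel_measurable borel"
    by (rule measurable_compose[OF _ mF]) (intro borel_measurable_continuous_onI continuous_intros)
  have "(\<integral>\<^sup>+ w\<in>ball 0 1. ennreal (symmetric_square f w powr (p / 2) * axis_weight lam (Im w)) \<partial>lborel)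
     \<le> (\<integral>\<^sup>+ w. ennreal (2 powr (p / 2)) * (?F w + ?F (cnj w)) \<partial>lborel)"
  proof (intro nn_integral_mono)
    fix w
    show "ennreal (symmetric_square f w powr (p / 2) * axis_weight lam (Im w)) * indicator (ball 0 1) w
      \<le> ennreal (2 powr (p / 2)) * (?F w + ?F (cnj w))"
    proof (cases "w \<in> ball 0 1")
      case True
      define a b where "a = norm (f w)" and "b = norm (f (cnj w))"
      have ab: "0 \<le> a" "0 \<le> b" by (auto simp: a_def b_def)
      have pow: "(2 * x\<^sup>2) powr (p / 2) = 2 powr (p / 2) * x powr p" if "0 \<le> x" for x :: real
        using that p by (cases "x = 0") (auto simp: powr_mult powr_powr simp flip: powr_numeral)
      have "(a\<^sup>2 + b\<^sup>2) powr (p / 2) \<le> (2 * (max a b)\<^sup>2) powr (p / 2)"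
        using ab p by (intro powr_mono2) (auto simp: max_def power_mono)
      also have "\<dots> = 2 powr (p / 2) * max a b powr p" using ab by (intro pow) auto
      also have "\<dots> \<le> 2 powr (p / 2) * (a powr p + b powr p)"
        by (intro mult_left_mono) (auto simp: max_def)
      finally have "symmetric_square f w powr (p / 2) \<le> 2 powr (p / 2) * (a powr p + b powr p)"
        by (simp add: symmetric_square_def a_def b_def)
      then have "symmetric_square f w powr (p / 2) * axis_weight lam (Im w)
         \<le> 2 powr (p / 2) * (a powr p + b powr p) * axis_weight lam (Im w)"
        by (rule mult_right_mono[OF _ axis_weight_nonneg])
      then have "ennreal (symmetric_square f w powr (p / 2) * axis_weight lam (Im w))
         \<le> ennreal (2 powr (p / 2) * (a powr p * axis_weight lam (Im w) + b powr p * axis_weight lam (Im w)))"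
        by (intro ennreal_leI) (simp add: algebra_simps)
      also have "\<dots> = ennreal (2 powr (p / 2)) * (ennreal (a powr p * axis_weight lam (Im w)) + ennreal (b powr p * axis_weight lam (Im w)))"
        using axis_weight_nonneg[of lam] by (simp add: ennreal_mult' ennreal_plus)
      also have "ennreal (b powr p * axis_weight lam (Im w)) = ?F (cnj w)"
        using True by (simp add: b_def axis_weight_def)
      finally show ?thesis using True by (simp add: a_def)
    qed simp
  qed
  also have "\<dots> = ennreal (2 powr (p / 2)) * ((\<integral>\<^sup>+ w. ?F w \<partial>lborel) + (\<integral>\<^sup>+ w. ?F (cnj w) \<partial>lborel))"
    using mF mF' by (simp add: nn_integral_cmult nn_integral_add)
  also have "(\<integral>\<^sup>+ w. ?F (cnj w) \<partial>lborel) = (\<integral>\<^sup>+ w. ?F w \<partial>lborel)"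
    by (rule nn_integral_cnj[OF mF])
  finally show ?thesis by (simp add: I_def)
qed

section \<open>The pointwise estimate\<close>

lemma norm_1_minus_square_le:
  fixes z :: complex assumes "norm z < 1"
  shows "norm (1 - z\<^sup>2) \<le> 2 * (\<bar>Im z\<bar> + (1 - norm z))"
proof -
  have "1 - z\<^sup>2 = (1 - of_real ((norm z)\<^sup>2)) + z * (cnj z - z)"
    by (simp only: complex_norm_square) (simp add: algebra_simps power2_eq_square)
  then have "norm (1 - z\<^sup>2) \<le> norm (1 - complex_of_real ((norm z)\<^sup>2)) + norm (z * (cnj z - z))"
    by (metis norm_triangle_ineq)
  also have "norm (1 - complex_of_real ((norm z)\<^sup>2)) = 1 - (norm z)\<^sup>2"
  proof -
    have "1 - complex_of_real ((norm z)\<^sup>2) = complex_of_real (1 - (norm z)\<^sup>2)" by simp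
    moreover have "(norm z)\<^sup>2 \<le> 1" using assms by (simp add: power_le_one)
    ultimately show ?thesis by (metis abs_of_nonneg diff_ge_0_iff_ge norm_of_real)
  qed
  also have "\<dots> \<le> 2 * (1 - norm z)"
    using sum_power2_ge_zero[of "1 - norm z" 0] by (simp add: power2_eq_square algebra_simps)
  also have "norm (z * (cnj z - z)) \<le> 2 * \<bar>Im z\<bar>"
  proof -
    have "cnj z - z = of_real (-2 * Im z) * \<i>" by (simp add: complex_eq_iff)
    then have "norm (cnj z - z) = 2 * \<bar>Im z\<bar>" by (simp add: norm_mult)
    then show ?thesis using assms by (simp add: norm_mult mult_left_le_one_le)
  qed
  finally show ?thesis by simp
qed

theorem theorem4p11:
  fixes lam p :: real
  assumes "lam \<ge> 0"
    and "p \<ge> 2 * lam / (2 * lam + 1)"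
    and "p > 0"
  shows "\<exists>c>0. \<forall>f\<in>bergman_space lam p. \<forall>z\<in>ball 0 1.
           norm (f z) \<le> c * ((1 - norm z) powr (- 2 / p) / norm (1 - z\<^sup>2) powr (2 * lam / p))
                          * bergman_norm lam p f"
proof -
  note lam = assms(1) and p = assms(3)
  obtain C where C: "0 < C"
    and mean: "\<And>u ux uy uxx uyy z N. weighted_subsolution lam u ux uy uxx uyy \<Longrightarrow> z \<in> ball 0 1 \<Longrightarrow> 0 < N \<Longrightarrow>
       (\<integral>\<^sup>+ w\<in>ball 0 1. ennreal (u w powr (p / 2) * axis_weight lam (Im w)) \<partial>lborel) \<le> ennreal N \<Longrightarrow>
       u z powr (p / 2) * ((1 - norm z)\<^sup>2 * axis_weight lam (\<bar>Im z\<bar> + (1 - norm z))) \<le> C * N"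
    using power_mean_value[OF lam, of "p / 2"] p by auto
  define A where "A = 2 * 2 powr (p / 2) / c_lambda lam"
  have A: "0 < A" using c_lambda_pos[OF lam] by (simp add: A_def)
  define K where "K = C * A * 2 powr (2 * lam)"
  have K: "0 < K" using C A by (simp add: K_def)
  show ?thesis
  proof (intro exI[of _ "K powr (1 / p)"] conjI ballI)
    show "0 < K powr (1 / p)" using K by simp
    fix f z assume f: "f \<in> bergman_space lam p" and z: "z \<in> ball (0 :: complex) 1"
    have fa: "lambda_analytic lam f" and fin: "bergman_integral lam p f < \<infinity>"
      using f by (auto simp: bergman_space_def)
    define B where "B = enn2real (bergman_integral lam p f)"
    have B: "0 \<le> B" "bergman_integral lam p f = ennreal B"
      using fin by (simp_all add: B_def)
    let ?I = "\<integral>\<^sup>+ w\<in>ball 0 1. ennreal (norm (f w) powr p * axis_weight lam (Im w)) \<partial>lborel"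
    have I: "?I = ennreal (B / c_lambda lam)"
    proof -
      have eq: "ennreal (c_lambda lam) * ?I = ennreal B"
        using bergman_integral_eq[OF lam p fa] B by simp
      show ?thesis
      proof (cases ?I)
        case (real x)
        then have "c_lambda lam * x = B"
          using eq c_lambda_pos[OF lam] B by (simp add: ennreal_mult'[symmetric])
        then have "x = B / c_lambda lam" using c_lambda_pos[OF lam] by auto
        then show ?thesis using real(2) by (simp only:)
      next
        case top
        then show ?thesis using eq c_lambda_pos[OF lam] by (simp add: ennreal_mult_top)
      qed
    qed
    obtain ux uy uxx uyy where sub: "weighted_subsolution lam (symmetric_square f) ux uy uxx uyy"
      using symmetric_square_subsolution[OF lam fa] .
    define d where "d = 1 - norm z"
    define Y where "Y = \<bar>Im z\<bar> + d"
    define n where "n = norm (1 - z\<^sup>2)"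
    have d: "0 < d" using z by (simp add: d_def)
    have Y: "0 < Y" using d by (simp add: Y_def)
    have n: "0 < n"
    proof -
      have "norm (z\<^sup>2) < 1" using z by (simp add: norm_power power_less_one_iff abs_square_less_1)
      then show ?thesis by (auto simp: n_def)
    qed
    \<comment> \<open>The mean value lemma asks for a positive bound, whereas \<open>B\<close> may be zero; the slack \<open>e\<close> is removed afterwards.\<close>
    have approx: "symmetric_square f z powr (p / 2) * (d\<^sup>2 * axis_weight lam Y) \<le> C * (A * B + e)" if e: "0 < e" for e
      unfolding d_def Y_def
    proof (rule mean[OF sub z])
      show "0 < A * B + e" using A B e by (simp add: add_nonneg_pos)
      have "(\<integral>\<^sup>+ w\<in>ball 0 1. ennreal (symmetric_square f w powr (p / 2) * axis_weight lam (Im w)) \<partial>lborel)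
         \<le> ennreal (2 powr (p / 2)) * (?I + ?I)"
        by (rule symmetric_square_integral_le[OF lam p fa])
      also have "\<dots> = ennreal (A * B)"
        using B c_lambda_pos[OF lam] unfolding I
        by (simp add: A_def ennreal_plus[symmetric] ennreal_mult'[symmetric] mult_ac del: ennreal_plus)
      also have "\<dots> \<le> ennreal (A * B + e)" using e by (intro ennreal_leI) simp
      finally show "(\<integral>\<^sup>+ w\<in>ball 0 1. ennreal (symmetric_square f w powr (p / 2) * axis_weight lam (Im w)) \<partial>lborel)
         \<le> ennreal (A * B + e)" .
    qed
    have "symmetric_square f z powr (p / 2) * (d\<^sup>2 * axis_weight lam Y) \<le> C * (A * B) + e" if "0 < e" for e
      using approx[of "e / C"] that C by (simp add: distrib_left)
    then have bound: "symmetric_square f z powr (p / 2) * (d\<^sup>2 * axis_weight lam Y) \<le> C * (A * B)"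
      by (rule field_le_epsilon)
    have "norm (f z) powr p = ((norm (f z))\<^sup>2) powr (p / 2)"
      using p by (cases "f z = 0") (auto simp: powr_powr simp flip: powr_numeral)
    also have "\<dots> \<le> symmetric_square f z powr (p / 2)"
      using p by (intro powr_mono2) (auto simp: symmetric_square_def)
    finally have "norm (f z) powr p * (d\<^sup>2 * axis_weight lam Y)
        \<le> symmetric_square f z powr (p / 2) * (d\<^sup>2 * axis_weight lam Y)"
      by (rule mult_right_mono) (simp add: axis_weight_nonneg)
    also note bound
    finally have "norm (f z) powr p * (d\<^sup>2 * axis_weight lam Y) \<le> C * (A * B)" .
    from mult_left_mono[OF this, of "2 powr (2 * lam)"]
    have scaled: "norm (f z) powr p * (d\<^sup>2 * (2 powr (2 * lam) * axis_weight lam Y)) \<le> 2 powr (2 * lam) * (C * (A * B))"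
      by (simp add: mult_ac)
    have "n powr (2 * lam) \<le> 2 powr (2 * lam) * axis_weight lam Y"
    proof -
      have "n powr (2 * lam) \<le> (2 * Y) powr (2 * lam)"
        using norm_1_minus_square_le[of z] z lam n by (intro powr_mono2) (auto simp: n_def Y_def d_def)
      then show ?thesis using Y by (simp add: powr_mult axis_weight_eq)
    qed
    then have "norm (f z) powr p * (d\<^sup>2 * n powr (2 * lam)) \<le> norm (f z) powr p * (d\<^sup>2 * (2 powr (2 * lam) * axis_weight lam Y))"
      by (intro mult_left_mono) auto
    also note scaled
    finally have "norm (f z) powr p * (d\<^sup>2 * n powr (2 * lam)) \<le> 2 powr (2 * lam) * (C * (A * B))" .
    then have "norm (f z) powr p \<le> K * B / (d\<^sup>2 * n powr (2 * lam))"
      using d n by (simp add: K_def pos_le_divide_eq mult_ac)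
    then have "(norm (f z) powr p) powr (1 / p) \<le> (K * B / (d\<^sup>2 * n powr (2 * lam))) powr (1 / p)"
      using p by (intro powr_mono2) auto
    also have "(norm (f z) powr p) powr (1 / p) = norm (f z)"
      using p by (simp add: powr_powr)
    also have "(K * B / (d\<^sup>2 * n powr (2 * lam))) powr (1 / p)
      = K powr (1 / p) * B powr (1 / p) / ((d\<^sup>2) powr (1 / p) * n powr (2 * lam / p))"
      using K B d n by (simp add: powr_divide powr_mult powr_powr)
    also have "(d\<^sup>2) powr (1 / p) = d powr (2 / p)"
      using d by (simp add: powr_powr flip: powr_numeral)
    also have "K powr (1 / p) * B powr (1 / p) / (d powr (2 / p) * n powr (2 * lam / p))
      = K powr (1 / p) * (d powr (- 2 / p) / n powr (2 * lam / p)) * B powr (1 / p)"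
      by (simp add: powr_minus_divide[of d "2 / p"])
    finally show "norm (f z) \<le> K powr (1 / p) * ((1 - norm z) powr (- 2 / p) / norm (1 - z\<^sup>2) powr (2 * lam / p))
                          * bergman_norm lam p f"
      by (simp add: d_def n_def bergman_norm_def B_def)
  qed
qed

end
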